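(* Let $v,w\in\mathbb{R}^2$ be linearly independent and let $\Lambda=\{nv+kw:(n,k)\in\mathbb{Z}^2\}$ be the lattice they generate. Put $D(\Lambda)=1/|\det(v,w)|$; this equals both the upper and lower Beurling density of $\Lambda$. Let $g\in L^2(\mathbb{R})$. \begin{enumerate} \item If $G(g,\Lambda)$ is minimal in $L^2(\mathbb{R})$, then it is uniformly minimal and $D(\Lambda)\le 1$. \item If $G(g,\Lambda)$ is complete in $L^2(\mathbb{R})$, then $D(\Lambda)\ge 1$. \end{enumerate}
   Context: For $g\in L^2(\mathbb{R})$ and $(a,b)\in\mathbb{R}^2$ put $g_{ab}(t)=e^{2\pi i b t}g(t-a)$. The Gabor system is $G(g,\Lambda)=\{g_{\lambda\mu}\}_{(\lambda,\mu)\in\Lambda}$. A system is minimal if no element lies in the closed linear span of the others. It is uniformly minimal if there is $\delta>0$ such that the distance from each element to the closed span of the others exceeds $\delta$. It is complete if its linear span is dense. *)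

theory Defs
  imports "HOL-Analysis.Analysis"
begin

definition L2 :: "(real \<Rightarrow> complex) set" where
  "L2 = {f. f \<in> borel_measurable lborel \<and> integrable lborel (\<lambda>x. (cmod (f x))^2)}"

definition l2norm :: "(real \<Rightarrow> complex) \<Rightarrow> real" where
  "l2norm f = sqrt (LINT x|lborel. (cmod (f x))^2)"

definition cspan :: "(real \<Rightarrow> complex) set \<Rightarrow> (real \<Rightarrow> complex) set" where
  "cspan S = {h. \<exists>F c. finite F \<and> F \<subseteq> S \<and> h = (\<lambda>t. \<Sum>f\<in>F. c f * f t)}"

definition in_closed_span :: "(real \<Rightarrow> complex) \<Rightarrow> (real \<Rightarrow> complex) set \<Rightarrow> bool" where
  "in_closed_span f S \<longleftrightarrow> (\<forall>\<epsilon>>0. \<exists>h\<in>cspan S. l2norm (\<lambda>t. f t - h t) < \<epsilon>)"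

definition l2dist_span :: "(real \<Rightarrow> complex) \<Rightarrow> (real \<Rightarrow> complex) set \<Rightarrow> real" where
  "l2dist_span f S = (INF h\<in>cspan S. l2norm (\<lambda>t. f t - h t))"

definition minimal_sys :: "'i set \<Rightarrow> ('i \<Rightarrow> real \<Rightarrow> complex) \<Rightarrow> bool" where
  "minimal_sys I e \<longleftrightarrow> (\<forall>p\<in>I. \<not> in_closed_span (e p) (e ` (I - {p})))"

definition unif_minimal_sys :: "'i set \<Rightarrow> ('i \<Rightarrow> real \<Rightarrow> complex) \<Rightarrow> bool" where
  "unif_minimal_sys I e \<longleftrightarrow> (\<exists>\<delta>>0. \<forall>p\<in>I. l2dist_span (e p) (e ` (I - {p})) > \<delta>)"

definition complete_sys :: "'i set \<Rightarrow> ('i \<Rightarrow> real \<Rightarrow> complex) \<Rightarrow> bool" where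
  "complete_sys I e \<longleftrightarrow> (\<forall>f\<in>L2. in_closed_span f (e ` I))"

definition tf_shift :: "(real \<Rightarrow> complex) \<Rightarrow> real \<times> real \<Rightarrow> real \<Rightarrow> complex" where
  "tf_shift g ab = (\<lambda>t. cis (2 * pi * snd ab * t) * g (t - fst ab))"

definition lattice :: "real \<times> real \<Rightarrow> real \<times> real \<Rightarrow> (real \<times> real) set" where
  "lattice v w = {of_int n *\<^sub>R v + of_int k *\<^sub>R w | n k. True}"

definition det2 :: "real \<times> real \<Rightarrow> real \<times> real \<Rightarrow> real" where
  "det2 v w = fst v * snd w - snd v * fst w"

definition lattice_density :: "real \<times> real \<Rightarrow> real \<times> real \<Rightarrow> real" where
  "lattice_density v w = 1 / \<bar>det2 v w\<bar>"

end

theory Submission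
  imports Defs
begin

text \<open>Idea. Let \<open>G(h, \<Gamma>)\<close> be complete and let \<open>G(u, \<Lambda>)\<close> be uniformly minimal. Completeness,
  continuity of time-frequency shifts and compactness of a fundamental cell of \<open>\<Gamma>\<close> give, for every
  \<open>\<epsilon>\<close>, a radius \<open>R\<close> such that every shift of \<open>u\<close> lies within \<open>\<epsilon>\<close> of the span of the shifts of \<open>h\<close>
  by the points of \<open>\<Gamma>\<close> at distance at most \<open>R\<close>. So in a large box with \<open>N\<close> points of \<open>\<Lambda>\<close> and \<open>M\<close>
  points of \<open>\<Gamma>\<close>, up to boundary effects, there are \<open>N\<close> vectors with a bounded biorthogonal family close
  to a space of dimension \<open>M\<close>; a trace estimate gives \<open>N (1 - \<epsilon> / \<delta>) \<le> M\<close>, hence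
  \<open>D(\<Lambda>) \<le> D(\<Gamma>)\<close>. The integer shifts of the indicator of the unit interval are an orthonormal basis
  with a lattice of density 1, and the comparison of the given system with it, in either role, yields
  both density bounds. Minimality of a lattice system is automatically uniform because
  time-frequency shifts by lattice points permute the system up to phases.\<close>

section \<open>The Hilbert space of square-integrable functions modulo null sets\<close>

text \<open>Completeness gives no control over the coefficients of the approximants. The trace
  estimate never looks at them: it uses only the distance to a subspace and its dimension. The box
  is measured in coordinates of a basis of \<Gamma>, so \<Gamma> contributes at most
  \<open>(2 * N + 1)\<^sup>2\<close> points and only \<Lambda> needs a count from below, by area.
  The radius \<open>R\<close> does not depend on \<open>N\<close>; shrinking the box for \<Lambda>
  to \<open>N - R\<close> loses a term of order \<open>N\<close> against counts of order
  \<open>N\<^sup>2\<close>. Inner products are real parts of the complex ones, so complex dimensions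
  are counted by doubling both families. The reference system has a further use: its span is dense,
  hence continuity of the shifts only has to be checked on its elements.\<close>

lemma L2_iff: "f \<in> L2 \<longleftrightarrow> f \<in> borel_measurable borel \<and> integrable lborel (\<lambda>x. (cmod (f x))\<^sup>2)"
  by (simp add: L2_def)

lemma L2_measurable [measurable_dest]: "f \<in> L2 \<Longrightarrow> f \<in> borel_measurable borel"
  by (simp add: L2_iff)

lemma borel_measurable_cis [measurable (raw)]:
  "f \<in> borel_measurable M \<Longrightarrow> (\<lambda>x. cis (f x)) \<in> borel_measurable M"
  by (rule borel_measurable_continuous_on[where f = cis, rotated]) (auto intro!: continuous_intros)

lemma borel_measurable_cnj [measurable (raw)]:
  "f \<in> borel_measurable M \<Longrightarrow> (\<lambda>x. cnj (f x)) \<in> borel_measurable M"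
  by (rule borel_measurable_continuous_on[where f = cnj, rotated]) (auto intro!: continuous_intros)

lemma L2_bound:
  assumes "f \<in> borel_measurable borel" "integrable lborel (\<lambda>x. (G x)\<^sup>2)"
    and "AE x in lborel. cmod (f x) \<le> G x"
  shows "f \<in> L2"
  unfolding L2_iff
proof (intro conjI Bochner_Integration.integrable_bound[OF assms(2)])
  show "AE x in lborel. norm ((cmod (f x))\<^sup>2) \<le> norm ((G x)\<^sup>2)"
    using assms(3) by eventually_elim (simp add: power_mono)
qed (use assms(1) in auto)

lemma L2_zero: "(\<lambda>t. 0) \<in> L2"
  by (simp add: L2_iff)

lemma square_add_le: "((a::real) + b)\<^sup>2 \<le> 2 * (a\<^sup>2 + b\<^sup>2)"
  using sum_squares_bound[of a b] by (simp add: power2_sum algebra_simps)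

lemma L2_add:
  assumes "f \<in> L2" "g \<in> L2"
  shows "(\<lambda>t. f t + g t) \<in> L2"
proof -
  note [measurable] = assms[THEN L2_measurable]
  have int: "integrable lborel (\<lambda>x. 2 * ((cmod (f x))\<^sup>2 + (cmod (g x))\<^sup>2))"
    using assms by (auto simp: L2_iff)
  have "(cmod (f x + g x))\<^sup>2 \<le> 2 * ((cmod (f x))\<^sup>2 + (cmod (g x))\<^sup>2)" for x
    using power_mono[OF norm_triangle_ineq[of "f x" "g x"] norm_ge_zero, of 2]
      square_add_le[of "cmod (f x)" "cmod (g x)"] by linarith
  then have "AE x in lborel. norm ((cmod (f x + g x))\<^sup>2) \<le> norm (2 * ((cmod (f x))\<^sup>2 + (cmod (g x))\<^sup>2))"
    by (intro AE_I2) simp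
  then have "integrable lborel (\<lambda>x. (cmod (f x + g x))\<^sup>2)"
    by (rule Bochner_Integration.integrable_bound[OF int, rotated]) measurable
  then show ?thesis
    by (simp add: L2_iff)
qed

lemma L2_cmult: "f \<in> L2 \<Longrightarrow> (\<lambda>t. c * f t) \<in> L2"
  by (auto simp: L2_iff norm_mult power_mult_distrib)

lemma L2_diff: "f \<in> L2 \<Longrightarrow> g \<in> L2 \<Longrightarrow> (\<lambda>t. f t - g t) \<in> L2"
  using L2_add[OF _ L2_cmult[of g "-1"], of f] by simp

lemma L2_sum: "(\<And>i. i \<in> A \<Longrightarrow> f i \<in> L2) \<Longrightarrow> (\<lambda>t. \<Sum>i\<in>A. f i t) \<in> L2"
  by (induction A rule: infinite_finite_induct) (auto intro: L2_zero L2_add)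

lemma L2_tf_shift:
  assumes "f \<in> L2"
  shows "tf_shift f z \<in> L2"
proof -
  note [measurable] = assms[THEN L2_measurable]
  have "integrable lborel (\<lambda>x. (cmod (f (- fst z + 1 * x)))\<^sup>2)"
    using assms by (subst lborel_integrable_real_affine_iff) (auto simp: L2_iff)
  then show ?thesis
    by (auto simp: L2_iff tf_shift_def norm_mult)
qed

lemma integrable_inner_L2:
  assumes "f \<in> L2" "g \<in> L2"
  shows "integrable lborel (\<lambda>t. Re (f t * cnj (g t)))"
proof (rule Bochner_Integration.integrable_bound)
  note [measurable] = assms[THEN L2_measurable]
  show "integrable lborel (\<lambda>x. (cmod (f x))\<^sup>2 + (cmod (g x))\<^sup>2)"
    using assms by (auto simp: L2_iff)
  have "\<bar>Re (f x * cnj (g x))\<bar> \<le> (cmod (f x))\<^sup>2 + (cmod (g x))\<^sup>2" for x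
  proof -
    have "\<bar>Re (f x * cnj (g x))\<bar> \<le> cmod (f x) * cmod (g x)"
      using abs_Re_le_cmod[of "f x * cnj (g x)"] by (simp add: norm_mult)
    also have "\<dots> \<le> (cmod (f x))\<^sup>2 + (cmod (g x))\<^sup>2"
      using sum_squares_bound[of "cmod (f x)" "cmod (g x)"] mult_nonneg_nonneg[of "cmod (f x)" "cmod (g x)"]
        norm_ge_zero[of "f x"] norm_ge_zero[of "g x"]
      by linarith
    finally show ?thesis .
  qed
  then show "AE x in lborel. norm (Re (f x * cnj (g x))) \<le> norm ((cmod (f x))\<^sup>2 + (cmod (g x))\<^sup>2)"
    by auto
  show "(\<lambda>t. Re (f t * cnj (g t))) \<in> borel_measurable lborel"
    by measurable
qed

lemma AE_tf_shift:
  assumes [measurable]: "f \<in> borel_measurable borel" "g \<in> borel_measurable borel"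
    and "AE x in lborel. f x = g x"
  shows "AE x in lborel. tf_shift f z x = tf_shift g z x"
proof -
  have "AE x in lborel. f (- fst z + 1 * x) = g (- fst z + 1 * x)"
    using assms(3) by (intro AE_borel_affine[where P = "\<lambda>x. f x = g x"]) auto
  then show ?thesis
    by eventually_elim (simp add: tf_shift_def)
qed

\<comment> \<open>Functions outside \<open>L2\<close> are related to nothing, hence a partial
  quotient. Passing to classes modulo null sets turns the seminorm \<open>l2norm\<close> into a
  norm, which makes closures, compactness and projections available.\<close>
quotient_type l2 = "real \<Rightarrow> complex" / partial:
  "\<lambda>f g. f \<in> L2 \<and> g \<in> L2 \<and> (AE x in lborel. f x = g x)"
proof (rule part_equivpI)
  show "\<exists>f. f \<in> L2 \<and> f \<in> L2 \<and> (AE x in lborel. f x = f x)"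
    using L2_zero by auto
  show "symp (\<lambda>f g. f \<in> L2 \<and> g \<in> L2 \<and> (AE x in lborel. f x = g x))"
    by (auto simp: symp_def elim: eventually_mono)
  show "transp (\<lambda>f g. f \<in> L2 \<and> g \<in> L2 \<and> (AE x in lborel. f x = g x))"
    by (auto simp: transp_def elim: eventually_elim2)
qed

instantiation l2 :: real_vector
begin

lift_definition zero_l2 :: l2 is "\<lambda>t. 0"
  by (simp add: L2_zero)

lift_definition plus_l2 :: "l2 \<Rightarrow> l2 \<Rightarrow> l2" is "\<lambda>f g t. f t + g t"
  by (auto intro: L2_add elim: eventually_elim2)

lift_definition minus_l2 :: "l2 \<Rightarrow> l2 \<Rightarrow> l2" is "\<lambda>f g t. f t - g t"
  by (auto intro: L2_diff elim: eventually_elim2)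

lift_definition uminus_l2 :: "l2 \<Rightarrow> l2" is "\<lambda>f t. - f t"
  using L2_cmult[of _ "-1"] by (auto elim: eventually_mono)

lift_definition scaleR_l2 :: "real \<Rightarrow> l2 \<Rightarrow> l2" is "\<lambda>r f t. of_real r * f t"
  by (auto intro: L2_cmult elim: eventually_mono)

instance
proof
  fix x y z :: l2 and a b :: real
  show "x + y + z = x + (y + z)"
    by transfer (auto intro!: L2_add simp: add.assoc)
  show "x + y = y + x"
    by transfer (auto intro!: L2_add simp: add.commute)
  show "0 + x = x"
    by transfer auto
  show "- x + x = 0"
    by transfer (auto intro: L2_zero)
  show "x - y = x + - y"
    by transfer (auto intro: L2_diff)
  show "a *\<^sub>R (x + y) = a *\<^sub>R x + a *\<^sub>R y"
    by transfer (auto intro!: L2_add L2_cmult simp: ring_distribs)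
  show "(a + b) *\<^sub>R x = a *\<^sub>R x + b *\<^sub>R x"
    by transfer (auto intro!: L2_add L2_cmult simp: ring_distribs)
  show "a *\<^sub>R b *\<^sub>R x = (a * b) *\<^sub>R x"
    by transfer (auto intro!: L2_cmult simp: mult.assoc)
  show "1 *\<^sub>R x = x"
    by transfer auto
qed

end

text \<open>The inner product is the real part of the complex one. It gives the same norm, but its
  orthogonality is weaker than complex orthogonality; the complex structure is kept separately in
  \<open>cscale\<close>.\<close>

instantiation l2 :: real_inner
begin

lift_definition inner_l2 :: "l2 \<Rightarrow> l2 \<Rightarrow> real" is "\<lambda>f g. LINT t|lborel. Re (f t * cnj (g t))"
proof (clarify, rule integral_cong_AE)
  fix f f' g g' :: "real \<Rightarrow> complex"
  assume "f \<in> L2" "f' \<in> L2" "g \<in> L2" "g' \<in> L2"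
  note [measurable] = this[THEN L2_measurable]
  show "(\<lambda>t. Re (f t * cnj (g t))) \<in> borel_measurable lborel"
    "(\<lambda>t. Re (f' t * cnj (g' t))) \<in> borel_measurable lborel"
    by measurable
  assume "AE x in lborel. f x = f' x" "AE x in lborel. g x = g' x"
  then show "AE x in lborel. Re (f x * cnj (g x)) = Re (f' x * cnj (g' x))"
    by eventually_elim simp
qed

definition norm_l2 :: "l2 \<Rightarrow> real" where "norm_l2 f = sqrt (inner f f)"
definition dist_l2 :: "l2 \<Rightarrow> l2 \<Rightarrow> real" where "dist_l2 f g = norm (f - g)"
definition sgn_l2 :: "l2 \<Rightarrow> l2" where "sgn_l2 (f::l2) = f /\<^sub>R norm f"
definition uniformity_l2 :: "(l2 \<times> l2) filter" where
  "uniformity_l2 = (INF e\<in>{0 <..}. principal {(x, y). dist x y < e})"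
definition open_l2 :: "l2 set \<Rightarrow> bool" where
  "open_l2 U \<longleftrightarrow> (\<forall>x\<in>U. \<forall>\<^sub>F (x', y) in uniformity. x' = x \<longrightarrow> y \<in> U)"

instance
proof
  fix x y z :: l2 and a b :: real
  show "inner x y = inner y x"
  proof transfer
    fix f g :: "real \<Rightarrow> complex"
    have "Re (f t * cnj (g t)) = Re (g t * cnj (f t))" for t
      by (simp add: mult.commute)
    then show "(LINT t|lborel. Re (f t * cnj (g t))) = (LINT t|lborel. Re (g t * cnj (f t)))"
      by (rule Bochner_Integration.integral_cong[OF refl])
  qed
  show "inner (x + y) z = inner x z + inner y z"
    by transfer (simp add: distrib_right integrable_inner_L2 del: times_complex.sel)
  show "inner (a *\<^sub>R x) y = a * inner x y"
  proof transfer
    fix a and f g :: "real \<Rightarrow> complex"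
    have "Re (of_real a * f t * cnj (g t)) = a * Re (f t * cnj (g t))" for t
      by (simp add: algebra_simps)
    then show "(LINT t|lborel. Re (of_real a * f t * cnj (g t))) = a * (LINT t|lborel. Re (f t * cnj (g t)))"
      by (simp only: Bochner_Integration.integral_mult_right_zero)
  qed
  show "0 \<le> inner x x"
  proof transfer
    fix f :: "real \<Rightarrow> complex"
    show "0 \<le> (LINT t|lborel. Re (f t * cnj (f t)))"
      by (rule Bochner_Integration.integral_nonneg) simp
  qed
  show "inner x x = 0 \<longleftrightarrow> x = 0"
  proof transfer
    fix f assume "f \<in> L2 \<and> f \<in> L2 \<and> (AE x in lborel. f x = f x)"
    then have f: "f \<in> L2" by simp
    have eq: "Re (f t * cnj (f t)) = (cmod (f t))\<^sup>2" for t
      by (metis Re_complex_of_real complex_norm_square)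
    have "(LINT t|lborel. (cmod (f t))\<^sup>2) = 0 \<longleftrightarrow> (AE t in lborel. (cmod (f t))\<^sup>2 = 0)"
      using f by (intro integral_nonneg_eq_0_iff_AE) (auto simp: L2_iff)
    then show "(LINT t|lborel. Re (f t * cnj (f t))) = 0 \<longleftrightarrow>
        f \<in> L2 \<and> (\<lambda>t. 0) \<in> L2 \<and> (AE x in lborel. f x = 0)"
      unfolding eq using f L2_zero by simp
  qed
  show "norm x = sqrt (inner x x)" by (simp add: norm_l2_def)
  show "dist x y = norm (x - y)" by (simp add: dist_l2_def)
  show "sgn x = x /\<^sub>R norm x" by (simp add: sgn_l2_def)
  show "uniformity = (INF e\<in>{0 <..}. principal {(x, y). dist x (y::l2) < e})"
    by (simp add: uniformity_l2_def)
  fix U :: "l2 set"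
  show "open U \<longleftrightarrow> (\<forall>x\<in>U. \<forall>\<^sub>F (x', y) in uniformity. x' = x \<longrightarrow> y \<in> U)"
    by (simp add: open_l2_def)
qed

end

lemma l2_cases [case_names abs, cases type: l2]:
  obtains f where "f \<in> L2" "x = abs_l2 f"
  by (induction x rule: l2.abs_induct) auto

lemma abs_l2_zero: "abs_l2 (\<lambda>t. 0) = 0"
  by (simp add: zero_l2.abs_eq)

lemma abs_l2_add: "f \<in> L2 \<Longrightarrow> g \<in> L2 \<Longrightarrow> abs_l2 (\<lambda>t. f t + g t) = abs_l2 f + abs_l2 g"
  by (simp add: plus_l2.abs_eq)

lemma abs_l2_diff: "f \<in> L2 \<Longrightarrow> g \<in> L2 \<Longrightarrow> abs_l2 (\<lambda>t. f t - g t) = abs_l2 f - abs_l2 g"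
  by (simp add: minus_l2.abs_eq)

lemma abs_l2_scaleR: "f \<in> L2 \<Longrightarrow> abs_l2 (\<lambda>t. of_real r * f t) = r *\<^sub>R abs_l2 f"
  by (simp add: scaleR_l2.abs_eq)

lemma abs_l2_sum:
  "(\<And>i. i \<in> A \<Longrightarrow> f i \<in> L2) \<Longrightarrow> abs_l2 (\<lambda>t. \<Sum>i\<in>A. f i t) = (\<Sum>i\<in>A. abs_l2 (f i))"
  by (induction A rule: infinite_finite_induct) (auto simp: abs_l2_zero abs_l2_add L2_sum)

lemma inner_abs_l2:
  "f \<in> L2 \<Longrightarrow> g \<in> L2 \<Longrightarrow> inner (abs_l2 f) (abs_l2 g) = (LINT t|lborel. Re (f t * cnj (g t)))"
  by (simp add: inner_l2.abs_eq)

lemma norm_abs_l2: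
  assumes "f \<in> L2"
  shows "norm (abs_l2 f) = l2norm f"
proof -
  have "Re (f t * cnj (f t)) = (cmod (f t))\<^sup>2" for t
    by (metis Re_complex_of_real complex_norm_square)
  then show ?thesis
    using assms by (simp add: norm_eq_sqrt_inner inner_abs_l2 l2norm_def)
qed

text \<open>\<open>G\<close> bounds the limit as well, so \<open>4 * (G x)\<^sup>2\<close> dominates
  the squared differences. Density and continuity of the reference system both rest on this.\<close>

lemma abs_l2_tendsto_dominated:
  assumes [measurable]: "\<And>n. f n \<in> borel_measurable borel" "h \<in> borel_measurable borel"
    and G: "integrable lborel (\<lambda>x. (G x)\<^sup>2)"
    and bound: "\<And>n. AE x in lborel. cmod (f n x) \<le> G x"
    and lim: "AE x in lborel. (\<lambda>n. f n x) \<longlonglongrightarrow> h x"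
  shows "h \<in> L2" "(\<lambda>n. abs_l2 (f n)) \<longlonglongrightarrow> abs_l2 h"
proof -
  have bound': "AE x in lborel. \<forall>n. cmod (f n x) \<le> G x"
    using bound by (simp add: AE_all_countable)
  with lim have hG: "AE x in lborel. cmod (h x) \<le> G x"
  proof eventually_elim
    case (elim x)
    from tendsto_norm[OF elim(1)] show ?case
      by (rule tendsto_upperbound) (use elim(2) in auto)
  qed
  have f: "f n \<in> L2" for n
    by (rule L2_bound[OF _ G bound]) simp
  show h: "h \<in> L2"
    by (rule L2_bound[OF _ G hG]) simp
  have "(\<lambda>n. LINT x|lborel. (cmod (f n x - h x))\<^sup>2) \<longlonglongrightarrow> (LINT x|(lborel :: real measure). (0::real))"
  proof (rule integral_dominated_convergence)
    show "integrable lborel (\<lambda>x. 4 * (G x)\<^sup>2)"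
      using G by simp
    show "AE x in lborel. (\<lambda>n. (cmod (f n x - h x))\<^sup>2) \<longlonglongrightarrow> 0"
      using lim
    proof eventually_elim
      case (elim x)
      then have "(\<lambda>n. (cmod (f n x - h x))\<^sup>2) \<longlonglongrightarrow> (cmod (h x - h x))\<^sup>2"
        by (intro tendsto_intros)
      then show ?case by simp
    qed
    fix n
    show "AE x in lborel. norm ((cmod (f n x - h x))\<^sup>2) \<le> 4 * (G x)\<^sup>2"
      using bound[of n] hG
    proof eventually_elim
      case (elim x)
      have "cmod (f n x - h x) \<le> 2 * G x"
        using elim norm_triangle_ineq4[of "f n x" "h x"] by linarith
      then have "(cmod (f n x - h x))\<^sup>2 \<le> (2 * G x)\<^sup>2"
        by (intro power_mono) auto
      then show ?case by (simp add: power_mult_distrib)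
    qed
  qed auto
  then have "(\<lambda>n. sqrt (LINT x|lborel. (cmod (f n x - h x))\<^sup>2)) \<longlonglongrightarrow> sqrt 0"
    by (intro tendsto_intros) simp
  then have "(\<lambda>n. norm (abs_l2 (f n) - abs_l2 h)) \<longlonglongrightarrow> 0"
    using f h by (simp add: L2_diff norm_abs_l2 l2norm_def flip: abs_l2_diff)
  then show "(\<lambda>n. abs_l2 (f n)) \<longlonglongrightarrow> abs_l2 h"
    by (simp add: LIM_zero_iff tendsto_norm_zero_iff)
qed

section \<open>Complex multiples, time-frequency shifts and complex spans\<close>

lift_definition cscale :: "complex \<Rightarrow> l2 \<Rightarrow> l2" is "\<lambda>c f t. c * f t"
  by (auto intro: L2_cmult elim: eventually_mono)

lift_definition tfs :: "real \<times> real \<Rightarrow> l2 \<Rightarrow> l2" is "\<lambda>z f. tf_shift f z"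
  by (clarify, intro conjI L2_tf_shift AE_tf_shift L2_measurable)

lemma cscale_abs_l2: "f \<in> L2 \<Longrightarrow> cscale c (abs_l2 f) = abs_l2 (\<lambda>t. c * f t)"
  by (simp add: cscale.abs_eq)

lemma tfs_abs_l2: "f \<in> L2 \<Longrightarrow> tfs z (abs_l2 f) = abs_l2 (tf_shift f z)"
  by (simp add: tfs.abs_eq)

lemma cscale_cscale: "cscale c (cscale d x) = cscale (c * d) x"
  by transfer (auto simp: mult.assoc intro!: L2_cmult)

lemma cscale_one: "cscale 1 x = x"
  by transfer auto

lemma cscale_add_right: "cscale c (x + y) = cscale c x + cscale c y"
  by transfer (auto simp: distrib_left intro!: L2_cmult L2_add)

lemma cscale_of_real: "cscale (of_real r) x = r *\<^sub>R x"
  by transfer (auto intro!: L2_cmult)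

lemma cscale_diff_left: "cscale (c - d) x = cscale c x - cscale d x"
  by transfer (auto simp: left_diff_distrib intro!: L2_cmult L2_diff)

lemma cscale_add_left: "cscale (c + d) x = cscale c x + cscale d x"
  by transfer (auto simp: distrib_right intro!: L2_cmult L2_add)

lemma linear_cscale: "linear (cscale c)"
  by (rule linearI) (auto simp: cscale_add_right cscale_cscale mult.commute simp flip: cscale_of_real)

lemma norm_cscale: "norm (cscale c x) = cmod c * norm x"
  by (cases x) (auto simp: cscale_abs_l2 norm_abs_l2 L2_cmult l2norm_def norm_mult
      power_mult_distrib real_sqrt_mult)

lemma tfs_cscale: "tfs z (cscale c x) = cscale c (tfs z x)"
proof (cases x)
  case (abs f)
  have "tf_shift (\<lambda>t. c * f t) z = (\<lambda>t. c * tf_shift f z t)"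
    by (simp add: tf_shift_def mult.left_commute)
  then show ?thesis
    using abs by (simp add: tfs_abs_l2 cscale_abs_l2 L2_cmult L2_tf_shift)
qed

lemma linear_tfs: "linear (tfs z)"
proof (rule linearI)
  fix x y :: l2 and r :: real
  show "tfs z (x + y) = tfs z x + tfs z y"
  proof (cases x; cases y)
    fix f g assume "f \<in> L2" "x = abs_l2 f" "g \<in> L2" "y = abs_l2 g"
    moreover have "tf_shift (\<lambda>t. f t + g t) z = (\<lambda>t. tf_shift f z t + tf_shift g z t)"
      by (simp add: tf_shift_def distrib_left)
    ultimately show ?thesis
      by (simp add: tfs_abs_l2 L2_tf_shift L2_add flip: abs_l2_add)
  qed
  show "tfs z (r *\<^sub>R x) = r *\<^sub>R tfs z x"
    by (simp add: tfs_cscale flip: cscale_of_real)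
qed

lemma norm_tfs: "norm (tfs z x) = norm x"
proof (cases x)
  case (abs f)
  have "(LINT t|lborel. (cmod (f (- fst z + 1 * t)))\<^sup>2) = (LINT t|lborel. (cmod (f t))\<^sup>2)"
    by (subst (2) lborel_integral_real_affine[where c = 1 and t = "- fst z"]) auto
  then show ?thesis
    using abs by (simp add: tfs_abs_l2 norm_abs_l2 L2_tf_shift l2norm_def)
      (simp add: tf_shift_def norm_mult)
qed

text \<open>Moving the translation of \<open>z\<close> past the modulation of \<open>z'\<close>
  costs a constant phase: the shifts form a projective representation of the plane. Norms and
  complex spans do not see the phase.\<close>

lemma tfs_tfs: "tfs z (tfs z' x) = cscale (cis (- 2 * pi * snd z' * fst z)) (tfs (z + z') x)"
proof (cases x)
  case (abs f)
  have "cis (2 * pi * snd z * t) * cis (2 * pi * snd z' * (t - fst z)) =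
      cis (- 2 * pi * snd z' * fst z) * cis (2 * pi * snd (z + z') * t)" for t
    by (simp add: cis_mult algebra_simps)
  then have "tf_shift (tf_shift f z') z = (\<lambda>t. cis (- 2 * pi * snd z' * fst z) * tf_shift f (z + z') t)"
    by (simp add: tf_shift_def fun_eq_iff diff_diff_eq mult.assoc[symmetric])
  then show ?thesis
    using abs by (simp add: tfs_abs_l2 cscale_abs_l2 L2_tf_shift)
qed

text \<open>The type carries real scalars only, so the complex span is encoded as the real span of
  all complex multiples.\<close>

definition cspan_l2 :: "l2 set \<Rightarrow> l2 set" where
  "cspan_l2 S = span {cscale c x | c x. x \<in> S}"

lemma subspace_cspan_l2: "subspace (cspan_l2 S)"
  by (simp add: cspan_l2_def)

lemma cspan_l2_base: "x \<in> S \<Longrightarrow> cscale c x \<in> cspan_l2 S"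
  by (auto simp: cspan_l2_def intro: span_base)

lemma cspan_l2_mono: "S \<subseteq> S' \<Longrightarrow> cspan_l2 S \<subseteq> cspan_l2 S'"
  unfolding cspan_l2_def by (rule span_mono) blast

lemma linear_image_cspan_l2_into:
  assumes "linear L" "subspace T" "\<And>s c. s \<in> S \<Longrightarrow> L (cscale c s) \<in> T" "x \<in> cspan_l2 S"
  shows "L x \<in> T"
  using assms(4) unfolding cspan_l2_def
proof (induction rule: span_induct)
  case base
  show ?case
    using assms(1,2) by (auto simp: subspace_def linear_0 linear_add linear_scale)
qed (use assms(3) in auto)

lemma cscale_cspan_l2: "x \<in> cspan_l2 S \<Longrightarrow> cscale c x \<in> cspan_l2 S"
  by (rule linear_image_cspan_l2_into[OF linear_cscale subspace_cspan_l2])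
    (auto simp: cscale_cscale intro: cspan_l2_base)

text \<open>The phase from \<open>tfs_tfs\<close> varies with the element, but every generator may
  be rescaled by its own complex factor, so only the index set moves.\<close>

lemma tfs_cspan_l2:
  assumes "x \<in> cspan_l2 ((\<lambda>z. tfs z u) ` Z)"
  shows "tfs z0 x \<in> cspan_l2 ((\<lambda>z. tfs z u) ` ((+) z0 ` Z))"
  by (rule linear_image_cspan_l2_into[OF linear_tfs subspace_cspan_l2 _ assms])
    (erule imageE, simp add: tfs_cscale tfs_tfs cscale_cscale, rule cspan_l2_base, blast)

lemma L2_cspan: "S \<subseteq> L2 \<Longrightarrow> cspan S \<subseteq> L2"
  by (auto simp: cspan_def intro!: L2_sum L2_cmult)

text \<open>The bridge between the spans of functions in the statement and the geometry of
  \<open>l2\<close>. The image of \<open>cspan S\<close> is a real subspace containing all complex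
  multiples of the generators, hence it contains their span.\<close>

lemma abs_l2_cspan:
  assumes "S \<subseteq> L2"
  shows "abs_l2 ` cspan S = cspan_l2 (abs_l2 ` S)"
proof
  show "abs_l2 ` cspan S \<subseteq> cspan_l2 (abs_l2 ` S)"
  proof safe
    fix h assume "h \<in> cspan S"
    then obtain F c where "finite F" "F \<subseteq> S" and h: "h = (\<lambda>t. \<Sum>f\<in>F. c f * f t)"
      by (auto simp: cspan_def)
    have "abs_l2 h = (\<Sum>f\<in>F. cscale (c f) (abs_l2 f))"
      unfolding h using \<open>F \<subseteq> S\<close> assms
      by (subst abs_l2_sum) (auto intro!: L2_cmult sum.cong simp: cscale_abs_l2 subset_iff)
    also have "\<dots> \<in> cspan_l2 (abs_l2 ` S)"
      using \<open>F \<subseteq> S\<close> by (intro subspace_sum[OF subspace_cspan_l2] cspan_l2_base) auto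
    finally show "abs_l2 h \<in> cspan_l2 (abs_l2 ` S)" .
  qed
  have "subspace (abs_l2 ` cspan S)"
  proof (rule subspaceI)
    have "(\<lambda>t. 0) \<in> cspan S"
      unfolding cspan_def by (intro CollectI exI[of _ "{}"]) auto
    then show "0 \<in> abs_l2 ` cspan S"
      using abs_l2_zero by (metis imageI)
  next
    fix x y assume "x \<in> abs_l2 ` cspan S" "y \<in> abs_l2 ` cspan S"
    then obtain F c F' c' where F: "finite F" "F \<subseteq> S" "finite F'" "F' \<subseteq> S"
      and xy: "x = abs_l2 (\<lambda>t. \<Sum>f\<in>F. c f * f t)" "y = abs_l2 (\<lambda>t. \<Sum>f\<in>F'. c' f * f t)"
      by (auto simp: cspan_def)
    \<comment> \<open>Coefficients are attached to functions, so both families are extended by zero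
      to the union of the two finite sets before they are added.\<close>
    define d where "d f = (if f \<in> F then c f else 0) + (if f \<in> F' then c' f else 0)" for f
    have *: "(\<Sum>f\<in>F \<union> F'. (if f \<in> A then a f else 0) * f t) = (\<Sum>f\<in>A. a f * f t)"
      if "A \<subseteq> F \<union> F'" for A t and a :: "(real \<Rightarrow> complex) \<Rightarrow> complex"
      by (rule sum.mono_neutral_cong_right) (use that F in auto)
    have "x + y = abs_l2 (\<lambda>t. (\<Sum>f\<in>F. c f * f t) + (\<Sum>f\<in>F'. c' f * f t))"
      unfolding xy using F assms by (subst abs_l2_add) (auto intro!: L2_sum L2_cmult)
    also have "(\<lambda>t. (\<Sum>f\<in>F. c f * f t) + (\<Sum>f\<in>F'. c' f * f t)) = (\<lambda>t. \<Sum>f\<in>F \<union> F'. d f * f t)"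
      by (simp add: d_def distrib_right sum.distrib *)
    finally have "x + y = abs_l2 (\<lambda>t. \<Sum>f\<in>F \<union> F'. d f * f t)" .
    moreover have "(\<lambda>t. \<Sum>f\<in>F \<union> F'. d f * f t) \<in> cspan S"
      using F unfolding cspan_def by (intro CollectI exI[of _ "F \<union> F'"] exI[of _ d]) auto
    ultimately show "x + y \<in> abs_l2 ` cspan S" by blast
  next
    fix r x assume "x \<in> abs_l2 ` cspan S"
    then obtain F c where F: "finite F" "F \<subseteq> S" and x: "x = abs_l2 (\<lambda>t. \<Sum>f\<in>F. c f * f t)"
      by (auto simp: cspan_def)
    have "r *\<^sub>R x = abs_l2 (\<lambda>t. \<Sum>f\<in>F. (of_real r * c f) * f t)"
      unfolding x using F assms
      by (subst abs_l2_scaleR[symmetric]) (auto intro!: L2_sum L2_cmult simp: sum_distrib_left mult.assoc)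
    moreover have "(\<lambda>t. \<Sum>f\<in>F. (of_real r * c f) * f t) \<in> cspan S"
      using F unfolding cspan_def by (intro CollectI exI[of _ F] exI[of _ "\<lambda>f. of_real r * c f"]) auto
    ultimately show "r *\<^sub>R x \<in> abs_l2 ` cspan S" by blast
  qed
  moreover have "cscale c (abs_l2 f) \<in> abs_l2 ` cspan S" if "f \<in> S" for c f
  proof -
    have "(\<lambda>t. c * f t) \<in> cspan S"
      using that unfolding cspan_def by (intro CollectI exI[of _ "{f}"] exI[of _ "\<lambda>_. c"]) auto
    then show ?thesis
      using that assms by (auto simp: cscale_abs_l2 subset_iff)
  qed
  ultimately show "cspan_l2 (abs_l2 ` S) \<subseteq> abs_l2 ` cspan S"
    unfolding cspan_l2_def by (intro span_minimal) auto
qed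

section \<open>Separated families near a finite-dimensional subspace\<close>

text \<open>An explicit formula in an orthogonal spanning set replaces the projection theorem of
  Hilbert spaces; finite dimension stands in for completeness.\<close>

lemma orthogonal_projection_exists:
  fixes a :: "'a::real_inner"
  assumes "finite B"
  obtains p where "p \<in> span B" "\<And>x. x \<in> span B \<Longrightarrow> inner (a - p) x = 0"
proof -
  obtain C where C: "finite C" "span C = span B" "pairwise orthogonal C"
    using basis_orthogonal[OF assms] by blast
  define p where "p = (\<Sum>c\<in>C. (inner c a / inner c c) *\<^sub>R c)"
  have "p \<in> span B"
    unfolding p_def C(2)[symmetric] by (intro span_sum span_scale span_base)
  moreover have "inner (a - p) x = 0" if "x \<in> span B" for x
    using that unfolding C(2)[symmetric]
  proof (induction rule: span_induct)
    case base
    show ?case by (auto simp: subspace_def inner_add_right)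
  next
    case (step x)
    have "inner p x = (\<Sum>c\<in>C. (inner c a / inner c c) * inner c x)"
      by (simp add: p_def inner_sum_left)
    \<comment> \<open>\<open>C\<close> may contain 0; for \<open>x = 0\<close> every term vanishes
      on both sides.\<close>
    also have "\<dots> = (\<Sum>c\<in>C. if c = x then inner x a else 0)"
      using C(3) step by (intro sum.cong) (auto simp: pairwise_def orthogonal_def)
    also have "\<dots> = inner a x"
      using C(1) step by (simp add: inner_commute)
    finally show ?case by (simp add: inner_diff_left)
  qed
  ultimately show ?thesis using that by blast
qed

lemma orthonormal_spanning_set_exists:
  fixes B :: "'a::real_inner set"
  assumes "finite B"
  obtains E where "finite E" "card E \<le> card B" "span E = span B"
    "\<And>e. e \<in> E \<Longrightarrow> norm e = 1" "pairwise orthogonal E"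
proof -
  obtain C where C: "finite C" "card C \<le> card B" "span C = span B" "pairwise orthogonal C"
    using basis_orthogonal[OF assms] by blast
  define E where "E = (\<lambda>c. c /\<^sub>R norm c) ` (C - {0})"
  have "finite E" using C by (simp add: E_def)
  moreover have "card E \<le> card B"
    using card_image_le[of "C - {0}" "\<lambda>c. c /\<^sub>R norm c"] card_mono[of C "C - {0}"] C
    by (fastforce simp: E_def)
  moreover have "span E = span B"
  proof -
    have "span E \<subseteq> span C"
      by (intro span_minimal) (auto simp: E_def intro: span_base span_scale)
    moreover have "c \<in> span E" if "c \<in> C" for c
    proof (cases "c = 0")
      case False
      then have "c /\<^sub>R norm c \<in> span E"
        using that by (intro span_base) (auto simp: E_def)
      from span_scale[OF this, of "norm c"] show ?thesis
        using False by simp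
    qed (simp add: span_zero)
    then have "span C \<subseteq> span E"
      by (intro span_minimal) auto
    ultimately show ?thesis using C(3) by simp
  qed
  moreover have "norm e = 1" if "e \<in> E" for e
  proof -
    from that obtain c where "e = c /\<^sub>R norm c" "c \<noteq> 0" by (auto simp: E_def)
    then show ?thesis by simp
  qed
  moreover have "pairwise orthogonal E"
    using C(4) unfolding E_def pairwise_def orthogonal_def by auto
  ultimately show ?thesis using that by blast
qed

text \<open>Up to scaling, \<open>d j\<close> is the part \<open>r\<close> of \<open>f j\<close>
  orthogonal to the other vectors. Separation says that \<open>r\<close> has norm at least \<delta>,
  and division by its squared norm leaves a vector of norm \<open>1 / norm r\<close>.\<close>

lemma biorthogonal_family_exists:
  fixes f :: "'i \<Rightarrow> 'a::real_inner"
  assumes F: "finite F" and "\<delta> > 0"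
    and sep: "\<And>i y. i \<in> F \<Longrightarrow> y \<in> span (f ` (F - {i})) \<Longrightarrow> \<delta> \<le> norm (f i - y)"
  obtains d where "\<And>i. i \<in> F \<Longrightarrow> d i \<in> span (f ` F)" "\<And>i. i \<in> F \<Longrightarrow> norm (d i) \<le> 1 / \<delta>"
    "\<And>i j. i \<in> F \<Longrightarrow> j \<in> F \<Longrightarrow> inner (f i) (d j) = (if i = j then 1 else 0)"
proof -
  have "\<exists>d. d \<in> span (f ` F) \<and> norm d \<le> 1 / \<delta> \<and> (\<forall>i\<in>F. inner (f i) d = (if i = j then 1 else 0))"
    if j: "j \<in> F" for j
  proof -
    obtain p where p: "p \<in> span (f ` (F - {j}))"
      "\<And>x. x \<in> span (f ` (F - {j})) \<Longrightarrow> inner (f j - p) x = 0"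
      using orthogonal_projection_exists[of "f ` (F - {j})" "f j"] F by auto
    define r where "r = f j - p"
    have r: "\<delta> \<le> norm r" using sep[OF j p(1)] by (simp add: r_def)
    have "p \<in> span (f ` F)"
      using p(1) span_mono[of "f ` (F - {j})" "f ` F"] by blast
    then have "r \<in> span (f ` F)"
      using j unfolding r_def by (intro span_diff span_base[of "f j"]) auto
    then have "r /\<^sub>R (norm r)\<^sup>2 \<in> span (f ` F)" by (rule span_scale)
    moreover have "norm (r /\<^sub>R (norm r)\<^sup>2) \<le> 1 / \<delta>"
      using r \<open>\<delta> > 0\<close> by (simp add: power2_eq_square frac_le divide_simps)
    moreover have "inner (f i) (r /\<^sub>R (norm r)\<^sup>2) = (if i = j then 1 else 0)" if "i \<in> F" for i
    proof (cases "i = j")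
      case True
      have "inner (f j) r = inner (f j - p) r + inner p r"
        by (simp flip: inner_add_left)
      also have "\<dots> = (norm r)\<^sup>2"
        using p(2)[OF p(1)] unfolding r_def by (simp add: power2_norm_eq_inner inner_commute[of p])
      finally have "inner (f j) r = (norm r)\<^sup>2" .
      moreover have "norm r \<noteq> 0" using r \<open>\<delta> > 0\<close> by linarith
      ultimately show ?thesis using True by simp
    next
      case False
      then have "inner r (f i) = 0"
        using p(2)[OF span_base, of "f i"] that by (auto simp: r_def)
      then show ?thesis using False by (simp add: inner_commute)
    qed
    ultimately show ?thesis by blast
  qed
  then obtain d where "\<forall>j\<in>F. d j \<in> span (f ` F) \<and> norm (d j) \<le> 1 / \<delta> \<and>
      (\<forall>i\<in>F. inner (f i) (d j) = (if i = j then 1 else 0))"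
    by metis
  then show ?thesis using that by blast
qed

text \<open>The vector \<open>P\<close> with coefficients \<open>inner e (d i)\<close> is the
  orthogonal projection of \<open>e\<close> onto the span of the \<open>f i\<close>. The sum on the
  left is \<open>inner P e\<close>, which equals the squared norm of \<open>P\<close>.\<close>

lemma biorthogonal_expansion:
  fixes f :: "'i \<Rightarrow> 'a::real_inner"
  assumes F: "finite F"
    and d: "\<And>i. i \<in> F \<Longrightarrow> d i \<in> span (f ` F)"
    and bi: "\<And>i j. i \<in> F \<Longrightarrow> j \<in> F \<Longrightarrow> inner (f i) (d j) = (if i = j then 1 else 0)"
  shows "(\<Sum>i\<in>F. inner e (d i) * inner (f i) e) \<le> (norm e)\<^sup>2"
proof -
  define P where "P = (\<Sum>i\<in>F. inner e (d i) *\<^sub>R f i)"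
  have f_in: "f i \<in> span (d ` F)" if i: "i \<in> F" for i
  proof -
    \<comment> \<open>Both families span the same space: \<open>f i\<close> minus its expansion in
      the dual family lies in the span of the \<open>f i\<close> and is orthogonal to it, hence
      vanishes.\<close>
    define x where "x = f i - (\<Sum>j\<in>F. inner (f i) (f j) *\<^sub>R d j)"
    have "inner x y = 0" if "y \<in> span (f ` F)" for y
      using that
    proof (induction rule: span_induct)
      case base
      show ?case by (auto simp: subspace_def inner_add_right)
    next
      case (step y)
      then obtain k where k: "k \<in> F" "y = f k" by auto
      have "(\<Sum>j\<in>F. inner (f i) (f j) * inner (d j) (f k)) = (\<Sum>j\<in>F. if j = k then inner (f i) (f k) else 0)"
        using bi k by (intro sum.cong) (auto simp: inner_commute[of "d _"])
      then show ?case
        using F k by (simp add: x_def inner_diff_left inner_sum_left)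
    qed
    moreover have "x \<in> span (f ` F)"
      unfolding x_def using i by (intro span_diff span_sum span_scale d) (auto intro: span_base)
    ultimately have "x = 0"
      by (metis inner_eq_zero_iff)
    then have "f i = (\<Sum>j\<in>F. inner (f i) (f j) *\<^sub>R d j)" by (simp add: x_def)
    also have "\<dots> \<in> span (d ` F)"
      by (intro span_sum span_scale span_base) auto
    finally show ?thesis .
  qed
  have "inner (e - P) y = 0" if "y \<in> span (d ` F)" for y
    using that
  proof (induction rule: span_induct)
    case base
    show ?case by (auto simp: subspace_def inner_add_right)
  next
    case (step y)
    then obtain k where k: "k \<in> F" "y = d k" by auto
    have "(\<Sum>i\<in>F. inner e (d i) * inner (f i) (d k)) = (\<Sum>i\<in>F. if i = k then inner e (d k) else 0)"
      using bi k by (intro sum.cong) auto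
    then show ?case
      using F k by (simp add: P_def inner_diff_left inner_sum_left)
  qed
  moreover have "P \<in> span (d ` F)"
    unfolding P_def by (intro span_sum span_scale f_in)
  ultimately have "inner (e - P) P = 0" by blast
  then have "inner P (e - P) = 0" by (simp only: inner_commute)
  then have P_e: "inner P e = (norm P)\<^sup>2"
    by (simp add: inner_diff_right power2_norm_eq_inner)
  moreover have "inner P e \<le> norm P * norm e" by (rule norm_cauchy_schwarz)
  ultimately have "norm P * norm P \<le> norm P * norm e" by (simp add: power2_eq_square)
  then have "norm P \<le> norm e"
    by (cases "norm P = 0") (auto simp: mult_le_cancel_left)
  then have "(norm P)\<^sup>2 \<le> (norm e)\<^sup>2" by (intro power_mono) auto
  moreover have "inner P e = (\<Sum>i\<in>F. inner e (d i) * inner (f i) e)"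
    by (simp add: P_def inner_sum_left)
  ultimately show ?thesis using P_e by linarith
qed

text \<open>Both sides of the estimate come from the trace of the product of the projection onto the span
  of \<open>B\<close> with the projection onto the span of the \<open>f i\<close>: it is at most the rank of the former, and its
  diagonal entries in the basis \<open>f\<close> are close to 1.\<close>

lemma card_separated_near_span_le:
  fixes f :: "'i \<Rightarrow> 'a::real_inner"
  assumes F: "finite F" and B: "finite B" and "\<delta> > 0"
    and sep: "\<And>i y. i \<in> F \<Longrightarrow> y \<in> span (f ` (F - {i})) \<Longrightarrow> \<delta> \<le> norm (f i - y)"
    and near: "\<And>i. i \<in> F \<Longrightarrow> \<exists>y\<in>span B. norm (f i - y) \<le> \<epsilon>"
  shows "real (card F) * (1 - \<epsilon> / \<delta>) \<le> real (card B)"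
proof -
  obtain d where d: "\<And>i. i \<in> F \<Longrightarrow> d i \<in> span (f ` F)" "\<And>i. i \<in> F \<Longrightarrow> norm (d i) \<le> 1 / \<delta>"
    and bi: "\<And>i j. i \<in> F \<Longrightarrow> j \<in> F \<Longrightarrow> inner (f i) (d j) = (if i = j then 1 else 0)"
    by (rule biorthogonal_family_exists[OF F \<open>\<delta> > 0\<close> sep]) auto
  obtain E where E: "finite E" "card E \<le> card B" "span E = span B"
    "\<And>e. e \<in> E \<Longrightarrow> norm e = 1" "pairwise orthogonal E"
    by (rule orthonormal_spanning_set_exists[OF B]) (rule that)
  \<comment> \<open>\<open>Q\<close> is the orthogonal projection onto the span of \<open>B\<close>,
    hence gives best approximations there.\<close>
  define Q where "Q x = (\<Sum>e\<in>E. inner x e *\<^sub>R e)" for x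
  have Q_orth: "inner (x - Q x) y = 0" if "y \<in> span B" for x y
    using that unfolding E(3)[symmetric]
  proof (induction rule: span_induct)
    case base
    show ?case by (auto simp: subspace_def inner_add_right)
  next
    case (step y)
    have "(\<Sum>e\<in>E. inner x e * inner e y) = (\<Sum>e\<in>E. if e = y then inner x y else 0)"
      using E(4,5) step
      by (intro sum.cong) (auto simp: pairwise_def orthogonal_def norm_eq_1)
    then show ?case
      using E(1) step by (simp add: Q_def inner_diff_left inner_sum_left)
  qed
  have Q_span: "Q x \<in> span B" for x
    unfolding Q_def E(3)[symmetric] by (intro span_sum span_scale span_base)
  have Q_near: "norm (x - Q x) \<le> norm (x - y)" if "y \<in> span B" for x y
  proof -
    have "inner (x - Q x) (Q x - y) = 0"
      using that Q_span by (intro Q_orth span_diff)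
    then have "(norm (x - y))\<^sup>2 = (norm (x - Q x))\<^sup>2 + (norm (Q x - y))\<^sup>2"
      using norm_add_Pythagorean[of "x - Q x" "Q x - y"] by (simp add: orthogonal_def)
    then have "(norm (x - Q x))\<^sup>2 \<le> (norm (x - y))\<^sup>2" by simp
    then show ?thesis by (rule power2_le_imp_le) simp
  qed
  \<comment> \<open>Biorthogonality makes \<open>inner (f i) (d i)\<close> equal to 1; replacing
    \<open>f i\<close> by \<open>Q (f i)\<close> lowers it by at most \<epsilon> times the bound
    \<open>1 / \<delta>\<close> for \<open>d i\<close>.\<close>
  have "1 - \<epsilon> / \<delta> \<le> inner (Q (f i)) (d i)" if i: "i \<in> F" for i
  proof -
    obtain y where "y \<in> span B" "norm (f i - y) \<le> \<epsilon>" using near[OF i] by blast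
    then have near_i: "norm (f i - Q (f i)) \<le> \<epsilon>" using Q_near[of y "f i"] by simp
    moreover have "inner (f i - Q (f i)) (d i) \<le> norm (f i - Q (f i)) * norm (d i)"
      by (rule norm_cauchy_schwarz)
    moreover have "norm (f i - Q (f i)) * norm (d i) \<le> \<epsilon> * (1 / \<delta>)"
      using near_i d(2)[OF i] order.trans[OF norm_ge_zero near_i] by (intro mult_mono) auto
    ultimately show ?thesis
      using bi[OF i i] by (simp add: inner_diff_left)
  qed
  then have "(\<Sum>i\<in>F. 1 - \<epsilon> / \<delta>) \<le> (\<Sum>i\<in>F. inner (Q (f i)) (d i))"
    by (rule sum_mono)
  \<comment> \<open>Regrouped over the orthonormal set \<open>E\<close>, the trace receives at most
    1 from each \<open>e\<close>.\<close>
  also have "\<dots> = (\<Sum>e\<in>E. \<Sum>i\<in>F. inner e (d i) * inner (f i) e)"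
    by (subst sum.swap) (simp add: Q_def inner_sum_left mult.commute)
  also have "\<dots> \<le> (\<Sum>e\<in>E. (norm e)\<^sup>2)"
    by (intro sum_mono biorthogonal_expansion[OF F d(1) bi]) auto
  also have "\<dots> = real (card E)"
    using E(4) by simp
  also have "\<dots> \<le> real (card B)" using E(2) by simp
  finally show ?thesis by simp
qed

section \<open>Comparing the densities of two lattices\<close>

text \<open>An area argument: the preimage of the square of half-side \<open>L - C\<close> under the
  matrix with rows \<open>(a, b)\<close> and \<open>(c, d)\<close> has area
  \<open>4 * (L - C)\<^sup>2 / \<bar>D\<bar>\<close> and is covered by the unit squares attached to
  the points of \<open>F\<close>. The margin \<open>C\<close> absorbs the rounding: lowering both
  coordinates by less than 1 moves the image by at most \<open>C\<close>.\<close>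

lemma card_lattice_points_ge:
  fixes a b c d L :: real
  defines "F \<equiv> {(n::int, k::int). \<bar>a * n + b * k\<bar> \<le> L \<and> \<bar>c * n + d * k\<bar> \<le> L}"
    and "C \<equiv> \<bar>a\<bar> + \<bar>b\<bar> + \<bar>c\<bar> + \<bar>d\<bar>" and "D \<equiv> a * d - b * c"
  assumes "D \<noteq> 0" "C \<le> L"
  shows "finite F" "4 * (L - C)\<^sup>2 \<le> \<bar>D\<bar> * real (card F)"
proof -
  \<comment> \<open>From Cramer's rule: \<open>D * n\<close> and \<open>D * k\<close> are
    combinations of the two box coordinates with coefficients among \<open>a\<close>,
    \<open>b\<close>, \<open>c\<close>, \<open>d\<close> up to sign.\<close>
  define K where "K = (\<bar>a\<bar> + \<bar>b\<bar> + \<bar>c\<bar> + \<bar>d\<bar>) * L / \<bar>D\<bar>"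
  have bound: "\<bar>real_of_int n\<bar> \<le> K \<and> \<bar>real_of_int k\<bar> \<le> K" if "(n, k) \<in> F" for n k
  proof -
    define x y where "x = a * n + b * k" and "y = c * n + d * k"
    have xy: "\<bar>x\<bar> \<le> L" "\<bar>y\<bar> \<le> L" using that by (auto simp: F_def x_def y_def)
    have m: "\<bar>p * q\<bar> \<le> \<bar>p\<bar> * L" if "\<bar>q\<bar> \<le> L" for p q
      using that by (simp add: abs_mult mult_left_mono)
    have L: "0 \<le> L" using xy(1) by linarith
    have nn: "0 \<le> \<bar>a\<bar> * L" "0 \<le> \<bar>b\<bar> * L" "0 \<le> \<bar>c\<bar> * L" "0 \<le> \<bar>d\<bar> * L"
      using L by simp_all
    have "\<bar>D * n\<bar> = \<bar>d * x - b * y\<bar>" "\<bar>D * k\<bar> = \<bar>a * y - c * x\<bar>"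
      by (simp_all add: D_def x_def y_def algebra_simps)
    then have "\<bar>D * n\<bar> \<le> C * L" "\<bar>D * k\<bar> \<le> C * L"
      using m[OF xy(1), of d] m[OF xy(2), of b] m[OF xy(2), of a] m[OF xy(1), of c] nn
        abs_triangle_ineq4[of "d * x" "b * y"] abs_triangle_ineq4[of "a * y" "c * x"]
      unfolding C_def distrib_right by linarith+
    then show ?thesis
      using \<open>D \<noteq> 0\<close> by (simp add: K_def C_def[symmetric] abs_mult pos_le_divide_eq mult.commute)
  qed
  have "F \<subseteq> {\<lfloor>- K\<rfloor>..\<lceil>K\<rceil>} \<times> {\<lfloor>- K\<rfloor>..\<lceil>K\<rceil>}"
  proof (rule subrelI)
    fix n k assume "(n, k) \<in> F"
    have "\<lfloor>- K\<rfloor> \<le> m \<and> m \<le> \<lceil>K\<rceil>" if "\<bar>real_of_int m\<bar> \<le> K" for m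
      using that by linarith
    then show "(n, k) \<in> {\<lfloor>- K\<rfloor>..\<lceil>K\<rceil>} \<times> {\<lfloor>- K\<rfloor>..\<lceil>K\<rceil>}"
      using bound[OF \<open>(n, k) \<in> F\<close>] by simp
  qed
  then show "finite F"
    by (rule finite_subset) simp
  \<comment> \<open>\<open>g\<close> inverts the matrix; it lives on \<open>real^2\<close> so that
    the determinant formula for areas of linear images applies.\<close>
  define g :: "real^2 \<Rightarrow> real^2" where "g p = vector [(d * p$1 - b * p$2) / D, (a * p$2 - c * p$1) / D]" for p
  define Q :: "(real^2) set" where "Q = cbox (vector [- (L - C), - (L - C)]) (vector [L - C, L - C])"
  have lin: "linear g"
    by (rule linearI) (simp_all add: g_def vec_eq_iff forall_2 vector_2 add_divide_distrib diff_divide_distrib algebra_simps)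
  have "det (matrix g) = 1 / D"
  proof -
    have "det (matrix g) = (d * a - b * c) / (D * D)"
      by (simp add: det_2 matrix_def g_def axis_def vector_2 diff_divide_distrib mult.commute)
    then show ?thesis using \<open>D \<noteq> 0\<close> by (simp add: D_def mult.commute)
  qed
  moreover have "measure lebesgue Q = (2 * (L - C))\<^sup>2"
    using \<open>C \<le> L\<close> by (simp add: Q_def content_cbox_cart interval_ne_empty_cart forall_2 vector_2 prod_2 UNIV_2 power2_eq_square)
  moreover have "Q \<in> lmeasurable" by (simp add: Q_def)
  ultimately have meas: "measure lebesgue (g ` Q) = (2 * (L - C))\<^sup>2 / \<bar>D\<bar>" "g ` Q \<in> lmeasurable"
    using measure_linear_image[OF lin, of Q] measurable_linear_image[OF lin, of Q] by simp_all
  define U :: "int \<times> int \<Rightarrow> (real^2) set" where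
    "U = (\<lambda>(n, k). cbox (vector [real_of_int n, real_of_int k]) (vector [real_of_int n + 1, real_of_int k + 1]))"
  have "g ` Q \<subseteq> (\<Union>p\<in>F. U p)"
  proof safe
    fix q :: "real^2" assume q: "q \<in> Q"
    define x y where "x = g q $ 1" and "y = g q $ 2"
    have q12: "a * x + b * y = q$1" "c * x + d * y = q$2"
    proof -
      have "D * (a * x + b * y) = D * q$1" "D * (c * x + d * y) = D * q$2"
        using \<open>D \<noteq> 0\<close> by (simp_all add: x_def y_def g_def vector_2 distrib_left) (simp_all add: D_def algebra_simps)
      then show "a * x + b * y = q$1" "c * x + d * y = q$2" using \<open>D \<noteq> 0\<close> by simp_all
    qed
    have qb: "\<bar>q$1\<bar> \<le> L - C" "\<bar>q$2\<bar> \<le> L - C"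
      using q by (auto simp: Q_def mem_box_cart forall_2 vector_2)
    have m: "\<bar>s * frac t\<bar> \<le> \<bar>s\<bar>" for s t :: real
      using frac_lt_1[of t] mult_left_mono[of "frac t" 1 "\<bar>s\<bar>"] by (simp add: abs_mult)
    have "a * \<lfloor>x\<rfloor> + b * \<lfloor>y\<rfloor> = q$1 - a * frac x - b * frac y"
      "c * \<lfloor>x\<rfloor> + d * \<lfloor>y\<rfloor> = q$2 - c * frac x - d * frac y"
      by (simp_all add: frac_def algebra_simps flip: q12)
    moreover have "\<bar>r - s * frac x - t * frac y\<bar> \<le> \<bar>r\<bar> + \<bar>s\<bar> + \<bar>t\<bar>" for r s t
      using m[of s x] m[of t y] abs_triangle_ineq4[of "r - s * frac x" "t * frac y"]
        abs_triangle_ineq4[of r "s * frac x"] by linarith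
    from this[of "q$1" a b] this[of "q$2" c d]
    have "\<bar>q$1 - a * frac x - b * frac y\<bar> \<le> L" "\<bar>q$2 - c * frac x - d * frac y\<bar> \<le> L"
      using qb abs_ge_zero[of a] abs_ge_zero[of b] abs_ge_zero[of c] abs_ge_zero[of d]
      unfolding C_def by linarith+
    ultimately have "(\<lfloor>x\<rfloor>, \<lfloor>y\<rfloor>) \<in> F"
      by (simp add: F_def)
    moreover have "g q \<in> U (\<lfloor>x\<rfloor>, \<lfloor>y\<rfloor>)"
      by (auto simp: U_def mem_box_cart forall_2 vector_2 x_def y_def intro: less_imp_le)
    ultimately show "g q \<in> (\<Union>p\<in>F. U p)" by blast
  qed
  moreover have U: "U p \<in> lmeasurable" "measure lebesgue (U p) = 1" for p
    by (auto simp: U_def content_cbox_cart interval_ne_empty_cart forall_2 vector_2 prod_2 UNIV_2 split: prod.splits)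
  ultimately have "measure lebesgue (g ` Q) \<le> measure lebesgue (\<Union>p\<in>F. U p)"
    using meas(2) \<open>finite F\<close> by (intro measure_mono_fmeasurable fmeasurable.finite_UN) auto
  also have "\<dots> \<le> (\<Sum>p\<in>F. measure lebesgue (U p))"
    using U \<open>finite F\<close> by (intro measure_UNION_le) auto
  also have "\<dots> = real (card F)" using U by simp
  finally show "4 * (L - C)\<^sup>2 \<le> \<bar>D\<bar> * real (card F)"
    using \<open>D \<noteq> 0\<close> unfolding meas power_mult_distrib by (simp add: divide_le_eq mult.commute)
qed

text \<open>Leading coefficients are compared: the left side grows like
  \<open>4 * q * N\<^sup>2\<close>, the right side like \<open>4 * N\<^sup>2\<close>. Square roots
  make the comparison linear in \<open>N\<close>.\<close>

lemma square_growth_imp_le_one: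
  fixes q K :: real
  assumes "q \<ge> 0" "\<And>N::nat. real N \<ge> K \<Longrightarrow> 4 * (real N - K)\<^sup>2 * q \<le> (2 * real N + 1)\<^sup>2"
  shows "q \<le> 1"
proof (rule ccontr)
  assume "\<not> q \<le> 1"
  then have t: "sqrt q > 1" by simp
  \<comment> \<open>Beyond the second threshold \<open>2 * (N - K) * sqrt q\<close> exceeds
    \<open>2 * N + 1\<close>; the first makes the assumption applicable.\<close>
  obtain N :: nat where N: "real N > max K ((K * sqrt q + 1) / (sqrt q - 1))"
    using reals_Archimedean2 by blast
  have "(2 * (real N - K) * sqrt q)\<^sup>2 = 4 * (real N - K)\<^sup>2 * q"
    unfolding power_mult_distrib using \<open>q \<ge> 0\<close> by simp
  then have "(2 * (real N - K) * sqrt q)\<^sup>2 \<le> (2 * real N + 1)\<^sup>2"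
    using assms(2)[of N] N by simp
  then have "2 * (real N - K) * sqrt q \<le> 2 * real N + 1"
    by (rule power2_le_imp_le) simp
  moreover have "real N * (sqrt q - 1) > K * sqrt q + 1"
    using N t by (simp add: divide_less_eq)
  ultimately show False by (simp add: algebra_simps)
qed

text \<open>Distance is the maximum norm of the coordinates relative to \<open>v\<close>,
  \<open>w\<close>. The centre is an arbitrary real point, since points of another lattice will
  serve as centres.\<close>

definition lattice_box :: "real \<times> real \<Rightarrow> real \<times> real \<Rightarrow> real \<Rightarrow> real \<Rightarrow> real \<Rightarrow> (real \<times> real) set" where
  "lattice_box v w x y R =
    {of_int n *\<^sub>R v + of_int k *\<^sub>R w | n k. \<bar>of_int n - x\<bar> \<le> R \<and> \<bar>of_int k - y\<bar> \<le> R}"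

text \<open>Compactness treats the fractional part of \<open>(x, y)\<close>; translation by the
  lattice point given by the integer part treats the rest. Such a translation is isometric and
  permutes the generators up to phases, so approximants for the cell are carried to equally good
  ones elsewhere.\<close>

lemma uniform_lattice_approximation:
  fixes v w :: "real \<times> real" and h u :: l2
  assumes complete: "closure (cspan_l2 ((\<lambda>z. tfs z h) ` lattice v w)) = UNIV"
    and cont: "continuous_on UNIV (\<lambda>z. tfs z u)" and "\<epsilon> > 0"
  obtains R :: nat where "\<And>x y. \<exists>s\<in>cspan_l2 ((\<lambda>z. tfs z h) ` lattice_box v w x y (real R)).
    norm (tfs (x *\<^sub>R v + y *\<^sub>R w) u - s) < \<epsilon>"
proof -
  define S where "S R = cspan_l2 ((\<lambda>z. tfs z h) ` lattice_box v w 0 0 (real R))" for R :: nat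
  have S_mono: "S R \<subseteq> S R'" if "R \<le> R'" for R R'
  proof -
    have "lattice_box v w 0 0 (real R) \<subseteq> lattice_box v w 0 0 (real R')"
      using that unfolding lattice_box_def by fastforce
    then show ?thesis unfolding S_def by (intro cspan_l2_mono image_mono)
  qed
  \<comment> \<open>The spans of growing boxes form a chain, so their union is a subspace; it
    contains all generators and is therefore dense.\<close>
  have "subspace (\<Union>R. S R)"
  proof (rule subspaceI)
    show "0 \<in> (\<Union>R. S R)"
      using subspace_0[OF subspace_cspan_l2] by (auto simp: S_def)
    fix x y assume "x \<in> (\<Union>R. S R)" "y \<in> (\<Union>R. S R)"
    then obtain R R' where "x \<in> S R" "y \<in> S R'" by auto
    then have "x \<in> S (max R R')" "y \<in> S (max R R')"
      using S_mono[of R "max R R'"] S_mono[of R' "max R R'"] by auto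
    then have "x + y \<in> S (max R R')"
      unfolding S_def by (rule subspace_add[OF subspace_cspan_l2])
    then show "x + y \<in> (\<Union>R. S R)" by blast
  next
    fix r x assume "x \<in> (\<Union>R. S R)"
    then show "r *\<^sub>R x \<in> (\<Union>R. S R)"
      unfolding S_def by (auto intro: subspace_scale[OF subspace_cspan_l2])
  qed
  moreover have "cscale c (tfs z h) \<in> (\<Union>R. S R)" if z_in: "z \<in> lattice v w" for c z
  proof -
    obtain n k where z: "z = of_int n *\<^sub>R v + of_int k *\<^sub>R w"
      using z_in unfolding lattice_def by blast
    have "\<bar>real_of_int m\<bar> \<le> real (nat (max \<bar>n\<bar> \<bar>k\<bar>))" if "m = n \<or> m = k" for m
      using that by auto
    then have "z \<in> lattice_box v w 0 0 (real (nat (max \<bar>n\<bar> \<bar>k\<bar>)))"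
      unfolding lattice_box_def z by fastforce
    then show ?thesis unfolding S_def by (blast intro: cspan_l2_base)
  qed
  ultimately have "cspan_l2 ((\<lambda>z. tfs z h) ` lattice v w) \<subseteq> (\<Union>R. S R)"
    unfolding cspan_l2_def[of "_ ` lattice v w"] by (intro span_minimal) auto
  then have dense: "closure (\<Union>R. S R) = UNIV"
    using complete closure_mono by blast
  define K where "K = (\<lambda>(x, y). tfs (x *\<^sub>R v + y *\<^sub>R w) u) ` ({0..1} \<times> {0..1})"
  have "continuous_on ({0..1} \<times> {0..1}) (\<lambda>(x, y). tfs (x *\<^sub>R v + y *\<^sub>R w) u)"
    unfolding split_beta by (intro continuous_on_compose2[OF cont] continuous_intros) auto
  then have K: "compact K"
    unfolding K_def by (intro compact_continuous_image compact_Times) auto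
  have cover: "K \<subseteq> (\<Union>R\<in>UNIV. \<Union>s\<in>S R. ball s \<epsilon>)"
  proof
    fix x
    have "x \<in> closure (\<Union>R. S R)" using dense by simp
    then obtain s where "s \<in> (\<Union>R. S R)" "dist s x < \<epsilon>"
      using \<open>\<epsilon> > 0\<close> unfolding closure_approachable by blast
    then show "x \<in> (\<Union>R. \<Union>s\<in>S R. ball s \<epsilon>)" by auto
  qed
  obtain C where C: "finite C" "K \<subseteq> (\<Union>R\<in>C. \<Union>s\<in>S R. ball s \<epsilon>)"
    by (rule compactE_image[OF K _ cover]) auto
  \<comment> \<open>The spans increase, so the largest index of the finite subcover serves all;
    inserting 0 keeps the maximum defined for an empty \<open>C\<close>.\<close>
  define R where "R = Max (insert 0 C)"
  have K_near: "\<exists>s\<in>S R. norm (x - s) < \<epsilon>" if x_in: "x \<in> K" for x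
  proof -
    obtain R' s where "R' \<in> C" "s \<in> S R'" "dist s x < \<epsilon>" using C(2) x_in by auto
    moreover have "R' \<le> R" using \<open>R' \<in> C\<close> C(1) by (auto simp: R_def)
    ultimately show ?thesis using S_mono[of R' R] by (auto simp: dist_norm norm_minus_commute)
  qed
  \<comment> \<open>The radius grows by 1 because a box around
    \<open>(\<lfloor>x\<rfloor>, \<lfloor>y\<rfloor>)\<close> is recentred at
    \<open>(x, y)\<close>.\<close>
  have "\<exists>s\<in>cspan_l2 ((\<lambda>z. tfs z h) ` lattice_box v w x y (real (R + 1))).
    norm (tfs (x *\<^sub>R v + y *\<^sub>R w) u - s) < \<epsilon>" for x y
  proof -
    define z0 where "z0 = of_int \<lfloor>x\<rfloor> *\<^sub>R v + of_int \<lfloor>y\<rfloor> *\<^sub>R w"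
    define z1 where "z1 = frac x *\<^sub>R v + frac y *\<^sub>R w"
    have z01: "z0 + z1 = x *\<^sub>R v + y *\<^sub>R w"
      by (simp add: z0_def z1_def frac_def algebra_simps)
    have "tfs z1 u \<in> K"
      unfolding K_def z1_def by (intro image_eqI[of _ _ "(frac x, frac y)"]) (auto intro: less_imp_le frac_lt_1)
    then obtain s where s: "s \<in> S R" "norm (tfs z1 u - s) < \<epsilon>" using K_near by blast
    \<comment> \<open>Cancels the phase that \<open>tfs_tfs\<close> produces when the shifts by
      \<open>z0\<close> and \<open>z1\<close> are composed.\<close>
    define \<theta> where "\<theta> = 2 * pi * snd z1 * fst z0"
    define s' where "s' = cscale (cis \<theta>) (tfs z0 s)"
    have "tfs (x *\<^sub>R v + y *\<^sub>R w) u = cscale (cis \<theta>) (tfs z0 (tfs z1 u))"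
      by (simp add: tfs_tfs z01 cscale_cscale \<theta>_def cis_mult cscale_one)
    then have "tfs (x *\<^sub>R v + y *\<^sub>R w) u - s' = cscale (cis \<theta>) (tfs z0 (tfs z1 u - s))"
      by (simp add: s'_def linear_diff[OF linear_cscale] linear_diff[OF linear_tfs])
    then have near: "norm (tfs (x *\<^sub>R v + y *\<^sub>R w) u - s') < \<epsilon>"
      using s by (simp add: norm_cscale norm_tfs)
    have "s' \<in> cspan_l2 ((\<lambda>z. tfs z h) ` ((+) z0 ` lattice_box v w 0 0 (real R)))"
      using s(1) unfolding S_def s'_def by (intro cscale_cspan_l2 tfs_cspan_l2)
    moreover have "(+) z0 ` lattice_box v w 0 0 (real R) \<subseteq> lattice_box v w x y (real (R + 1))"
    proof
      fix p assume "p \<in> (+) z0 ` lattice_box v w 0 0 (real R)"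
      then obtain q where q: "p = z0 + q" "q \<in> lattice_box v w 0 0 (real R)" by blast
      then obtain n k where nk: "q = of_int n *\<^sub>R v + of_int k *\<^sub>R w" "\<bar>real_of_int n\<bar> \<le> R" "\<bar>real_of_int k\<bar> \<le> R"
        unfolding lattice_box_def by force
      have fl: "\<bar>of_int (n + \<lfloor>x\<rfloor>) - x\<bar> \<le> real (R + 1)" if "\<bar>real_of_int n\<bar> \<le> R" for n x
        using that by (simp, linarith)
      have "p = of_int (n + \<lfloor>x\<rfloor>) *\<^sub>R v + of_int (k + \<lfloor>y\<rfloor>) *\<^sub>R w"
        unfolding q(1) nk by (simp add: z0_def algebra_simps)
      then show "p \<in> lattice_box v w x y (real (R + 1))"
        using fl[OF nk(2)] fl[OF nk(3)] unfolding lattice_box_def by blast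
    qed
    ultimately have "s' \<in> cspan_l2 ((\<lambda>z. tfs z h) ` lattice_box v w x y (real (R + 1)))"
      by (metis subsetD[OF cspan_l2_mono[OF image_mono]])
    then show ?thesis using near by blast
  qed
  then show ?thesis using that by blast
qed

section \<open>From real to complex dimension counts\<close>

lemma cspan_l2_eq_span: "cspan_l2 S = span (S \<union> cscale \<i> ` S)"
proof
  have "cscale c x \<in> span (S \<union> cscale \<i> ` S)" if "x \<in> S" for c x
  proof -
    have "c = of_real (Re c) + of_real (Im c) * \<i>"
      by (simp add: complex_eq_iff)
    then have "cscale c x = cscale (of_real (Re c) + of_real (Im c) * \<i>) x"
      by (rule arg_cong)
    also have "\<dots> = Re c *\<^sub>R x + Im c *\<^sub>R cscale \<i> x"
      by (simp only: cscale_add_left cscale_of_real cscale_cscale[symmetric])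
    also have "\<dots> \<in> span (S \<union> cscale \<i> ` S)"
      using that by (intro span_add span_scale span_base) auto
    finally show ?thesis .
  qed
  then show "cspan_l2 S \<subseteq> span (S \<union> cscale \<i> ` S)"
    unfolding cspan_l2_def by (intro span_minimal) auto
  have "x \<in> cspan_l2 S" if "x \<in> S" for x
    using cspan_l2_base[OF that, of 1] by (simp add: cscale_one)
  then show "span (S \<union> cscale \<i> ` S) \<subseteq> cspan_l2 S"
    by (intro span_minimal subspace_cspan_l2) (auto intro: cspan_l2_base)
qed

text \<open>A complex subspace is invariant under division by \<open>c\<close>, so the distance of
  \<open>cscale c x\<close> from it is \<open>cmod c\<close> times that of \<open>x\<close>.\<close>

lemma complex_separation:
  assumes "\<And>y. y \<in> cspan_l2 S \<Longrightarrow> \<delta> \<le> norm (x - y)" and "0 \<le> \<delta>"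
    and "y \<in> cspan_l2 S" "cmod c \<ge> 1"
  shows "\<delta> \<le> norm (cscale c x - y)"
proof -
  have "c \<noteq> 0" using assms(4) by auto
  have "\<delta> \<le> norm (x - cscale (1 / c) y)"
    using assms by (intro assms(1) cscale_cspan_l2)
  also have "\<dots> \<le> cmod c * norm (x - cscale (1 / c) y)"
    using assms(4) mult_right_mono[of 1 "cmod c" "norm (x - cscale (1 / c) y)"] by simp
  also have "\<dots> = norm (cscale c (x - cscale (1 / c) y))"
    by (simp add: norm_cscale)
  also have "cscale c (x - cscale (1 / c) y) = cscale c x - y"
    using \<open>c \<noteq> 0\<close> by (simp add: linear_diff[OF linear_cscale] cscale_cscale cscale_one)
  finally show ?thesis .
qed

text \<open>Each \<open>f i\<close> is replaced by the pair \<open>f i\<close>,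
  \<open>cscale \<i> (f i)\<close>, and \<open>B\<close> by \<open>B\<close> together with its
  \<open>\<i>\<close>-multiples; the factor 2 cancels. What needs care is the separation of a vector
  from its own partner.\<close>

lemma card_complex_separated_near_span_le:
  fixes f :: "'i \<Rightarrow> l2"
  assumes F: "finite F" and B: "finite B" and "\<delta> > 0"
    and sep: "\<And>i y. i \<in> F \<Longrightarrow> y \<in> cspan_l2 (f ` (F - {i})) \<Longrightarrow> \<delta> \<le> norm (f i - y)"
    and near: "\<And>i. i \<in> F \<Longrightarrow> \<exists>y\<in>cspan_l2 B. norm (f i - y) \<le> \<epsilon>"
  shows "real (card F) * (1 - \<epsilon> / \<delta>) \<le> real (card B)"
proof -
  define \<alpha> where "\<alpha> b = (if b then \<i> else 1)" for b
  define f' where "f' = (\<lambda>(i, b). cscale (\<alpha> b) (f i))"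
  have "real (card (F \<times> (UNIV :: bool set))) * (1 - \<epsilon> / \<delta>) \<le> real (card (B \<union> cscale \<i> ` B))"
  proof (rule card_separated_near_span_le[OF _ _ \<open>\<delta> > 0\<close>, where f = f'])
    show "finite (F \<times> (UNIV :: bool set))" "finite (B \<union> cscale \<i> ` B)"
      using F B by auto
  next
    fix p y assume p: "p \<in> F \<times> (UNIV :: bool set)" and y: "y \<in> span (f' ` (F \<times> UNIV - {p}))"
    obtain i b where ib: "p = (i, b)" "i \<in> F" using p by auto
    have "f' ` (F \<times> UNIV - {p}) \<subseteq> insert (f' (i, \<not> b)) (f' ` ((F - {i}) \<times> UNIV))"
      using ib by auto
    then have "y \<in> span (insert (f' (i, \<not> b)) (f' ` ((F - {i}) \<times> UNIV)))"
      using y span_mono by blast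
    \<comment> \<open>Splitting off a real multiple of the partner of \<open>f' p\<close> leaves an
      element of the complex span of the other \<open>f j\<close>.\<close>
    then obtain r where r: "y - r *\<^sub>R f' (i, \<not> b) \<in> span (f' ` ((F - {i}) \<times> UNIV))"
      by (auto simp: span_breakdown_eq)
    have "span (f' ` ((F - {i}) \<times> UNIV)) \<subseteq> cspan_l2 (f ` (F - {i}))"
      by (intro span_minimal subspace_cspan_l2) (auto simp: f'_def intro!: cspan_l2_base)
    then have "y - r *\<^sub>R f' (i, \<not> b) \<in> cspan_l2 (f ` (F - {i}))" using r by blast
    \<comment> \<open>1 and \<open>\<i>\<close> are orthogonal in the plane, so subtracting a real
      multiple of one from the other cannot make it shorter: the partner does not reduce
      \<delta>.\<close>
    moreover have "1 \<le> cmod (\<alpha> b - of_real r * \<alpha> (\<not> b))"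
      by (auto simp: \<alpha>_def cmod_def)
    ultimately have "\<delta> \<le> norm (cscale (\<alpha> b - of_real r * \<alpha> (\<not> b)) (f i) - (y - r *\<^sub>R f' (i, \<not> b)))"
      using sep[OF ib(2)] \<open>\<delta> > 0\<close> by (intro complex_separation) auto
    also have "cscale (\<alpha> b - of_real r * \<alpha> (\<not> b)) (f i) - (y - r *\<^sub>R f' (i, \<not> b)) = f' p - y"
      by (simp add: f'_def ib cscale_diff_left cscale_cscale[symmetric] cscale_of_real)
    finally show "\<delta> \<le> norm (f' p - y)" .
  next
    fix p assume "p \<in> F \<times> (UNIV :: bool set)"
    then obtain i b where ib: "p = (i, b)" "i \<in> F" by auto
    obtain y where y: "y \<in> cspan_l2 B" "norm (f i - y) \<le> \<epsilon>" using near[OF ib(2)] by blast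
    have "norm (f' p - cscale (\<alpha> b) y) = norm (f i - y)"
      by (simp add: ib f'_def norm_cscale \<alpha>_def flip: linear_diff[OF linear_cscale])
    moreover have "cscale (\<alpha> b) y \<in> span (B \<union> cscale \<i> ` B)"
      using cscale_cspan_l2[OF y(1)] by (simp add: cspan_l2_eq_span)
    ultimately show "\<exists>y\<in>span (B \<union> cscale \<i> ` B). norm (f' p - y) \<le> \<epsilon>"
      using y(2) by (intro bexI[of _ "cscale (\<alpha> b) y"]) auto
  qed
  moreover have "card (B \<union> cscale \<i> ` B) \<le> 2 * card B"
    using card_Un_le[of B "cscale \<i> ` B"] card_image_le[OF B, of "cscale \<i>"] by linarith
  moreover have "real (card (F \<times> (UNIV :: bool set))) * (1 - \<epsilon> / \<delta>) = 2 * (real (card F) * (1 - \<epsilon> / \<delta>))"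
    by (simp add: card_cartesian_product)
  ultimately show ?thesis by linarith
qed

text \<open>Cramer's rule in the plane.\<close>

lemma lattice_coordinates:
  assumes "det2 v w \<noteq> 0"
  shows "z = (det2 z w / det2 v w) *\<^sub>R v + (det2 v z / det2 v w) *\<^sub>R w"
  using assms by (auto simp: prod_eq_iff det2_def divide_simps) (auto simp: algebra_simps)

lemma lattice_point_inj:
  assumes "det2 v w \<noteq> 0" "x *\<^sub>R v + y *\<^sub>R w = x' *\<^sub>R v + y' *\<^sub>R w"
  shows "x = x' \<and> y = y'"
proof -
  have "det2 (x *\<^sub>R v + y *\<^sub>R w) w = x * det2 v w" "det2 v (x *\<^sub>R v + y *\<^sub>R w) = y * det2 v w" for x y
    by (auto simp: det2_def algebra_simps)
  then show ?thesis using assms by (metis mult_right_cancel)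
qed

lemma finite_card_lattice_box:
  shows "finite (lattice_box v w 0 0 (real N))" "card (lattice_box v w 0 0 (real N)) \<le> (2 * N + 1)\<^sup>2"
proof -
  have "\<bar>real_of_int n\<bar> \<le> real N \<longleftrightarrow> n \<in> {- int N..int N}" for n
    by (auto simp: abs_le_iff)
  then have eq: "lattice_box v w 0 0 (real N) =
      (\<lambda>(n, k). of_int n *\<^sub>R v + of_int k *\<^sub>R w) ` ({- int N..int N} \<times> {- int N..int N})"
    unfolding lattice_box_def by (simp add: set_eq_iff image_iff Bex_def) blast
  then show "finite (lattice_box v w 0 0 (real N))" by simp
  have "card ({- int N..int N} \<times> {- int N..int N}) = (2 * N + 1)\<^sup>2"
    by (simp add: card_cartesian_product power2_eq_square nat_add_distrib nat_mult_distrib)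
  then show "card (lattice_box v w 0 0 (real N)) \<le> (2 * N + 1)\<^sup>2"
    unfolding eq by (metis card_image_le finite_SigmaI finite_atLeastAtMost_int)
qed

text \<open>The pairs \<open>(a, c)\<close> and \<open>(b, d)\<close> are the coordinates of
  \<open>v'\<close> and \<open>w'\<close> in the basis \<open>v\<close>, \<open>w\<close>, so
  \<open>D\<close> is the quotient of the two determinants and the claim is
  \<open>1 \<le> \<bar>D\<bar>\<close>. Counting gives \<open>4 * (N - R - C)\<^sup>2 * (1 - \<eta>)
  / \<bar>D\<bar> \<le> (2 * N + 1)\<^sup>2\<close> for all large \<open>N\<close>.\<close>

lemma density_comparison:
  fixes h u :: l2 and v w v' w' :: "real \<times> real"
  assumes det: "det2 v w \<noteq> 0" "det2 v' w' \<noteq> 0"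
    and complete: "closure (cspan_l2 ((\<lambda>z. tfs z h) ` lattice v w)) = UNIV"
    and cont: "continuous_on UNIV (\<lambda>z. tfs z u)" and "\<delta> > 0"
    and sep: "\<And>p y. p \<in> lattice v' w' \<Longrightarrow>
      y \<in> cspan_l2 ((\<lambda>z. tfs z u) ` (lattice v' w' - {p})) \<Longrightarrow> \<delta> \<le> norm (tfs p u - y)"
  shows "\<bar>det2 v w\<bar> \<le> \<bar>det2 v' w'\<bar>"
proof -
  define a where "a = det2 v' w / det2 v w"
  define b where "b = det2 w' w / det2 v w"
  define c where "c = det2 v v' / det2 v w"
  define d where "d = det2 v w' / det2 v w"
  define D where "D = a * d - b * c"
  have D: "D = det2 v' w' / det2 v w"
  proof -
    have "D * (det2 v w)\<^sup>2 = det2 v' w' * det2 v w"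
      using det(1) unfolding D_def a_def b_def c_def d_def by (simp add: field_simps power2_eq_square) (simp add: det2_def algebra_simps)
    then show ?thesis using det(1) by (simp add: field_simps power2_eq_square)
  qed
  then have "D \<noteq> 0" using det by simp
  define pt where "pt = (\<lambda>(n::int, k::int). of_int n *\<^sub>R v' + of_int k *\<^sub>R w')"
  have pt: "pt (n, k) = (a * n + b * k) *\<^sub>R v + (c * n + d * k) *\<^sub>R w" for n k
    unfolding pt_def a_def b_def c_def d_def
    by (subst (1) lattice_coordinates[OF det(1), of v'], subst (1) lattice_coordinates[OF det(1), of w'])
      (simp add: algebra_simps)
  have pt_inj: "p = q" if "pt p = pt q" for p q
    using lattice_point_inj[OF det(2)] that unfolding pt_def by (force split: prod.splits)
  have pt_lattice: "pt p \<in> lattice v' w'" for p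
    by (auto simp: pt_def lattice_def split: prod.splits)
  define C where "C = \<bar>a\<bar> + \<bar>b\<bar> + \<bar>c\<bar> + \<bar>d\<bar>"
  \<comment> \<open>\<eta> is the relative error in the trace estimate, so the approximation is
    carried out to within \<open>\<eta> * \<delta>\<close>.\<close>
  have main: "(1 - \<eta>) / \<bar>D\<bar> \<le> 1" if \<eta>: "0 < \<eta>" "\<eta> < 1" for \<eta> :: real
  proof -
    obtain R :: nat where R: "\<And>x y. \<exists>s\<in>cspan_l2 ((\<lambda>z. tfs z h) ` lattice_box v w x y (real R)).
        norm (tfs (x *\<^sub>R v + y *\<^sub>R w) u - s) < \<eta> * \<delta>"
      using uniform_lattice_approximation[OF complete cont, of "\<eta> * \<delta>"] \<eta> \<open>\<delta> > 0\<close> by auto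
    show ?thesis
    proof (rule square_growth_imp_le_one[where K = "real R + C"])
      show "0 \<le> (1 - \<eta>) / \<bar>D\<bar>" using \<eta> by simp
      fix N :: nat assume N: "real R + C \<le> real N"
      \<comment> \<open>The margin \<open>R\<close> keeps the approximating boxes around points of
        \<open>F\<close> inside the box of radius \<open>N\<close> from which \<open>B\<close> is
        formed.\<close>
      define F where "F = {(n::int, k::int). \<bar>a * n + b * k\<bar> \<le> real N - R \<and> \<bar>c * n + d * k\<bar> \<le> real N - R}"
      have F: "finite F" "4 * (real N - R - C)\<^sup>2 \<le> \<bar>D\<bar> * real (card F)"
        using card_lattice_points_ge[where a = a and b = b and c = c and d = d and L = "real N - R",
            folded F_def C_def D_def, OF \<open>D \<noteq> 0\<close>] N by simp_all
      define B where "B = (\<lambda>z. tfs z h) ` lattice_box v w 0 0 (real N)"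
      have B: "finite B" "card B \<le> (2 * N + 1)\<^sup>2"
        unfolding B_def using finite_card_lattice_box[where v = v and w = w and N = N]
        by (auto intro: order.trans[OF card_image_le])
      have "real (card F) * (1 - \<eta> * \<delta> / \<delta>) \<le> real (card B)"
      proof (rule card_complex_separated_near_span_le[OF F(1) B(1) \<open>\<delta> > 0\<close>, where f = "\<lambda>p. tfs (pt p) u"])
        fix p y assume "p \<in> F" and y: "y \<in> cspan_l2 ((\<lambda>p. tfs (pt p) u) ` (F - {p}))"
        have "(\<lambda>p. tfs (pt p) u) ` (F - {p}) \<subseteq> (\<lambda>z. tfs z u) ` (lattice v' w' - {pt p})"
          using pt_inj pt_lattice by blast
        then show "\<delta> \<le> norm (tfs (pt p) u - y)"
          using y cspan_l2_mono by (intro sep[OF pt_lattice]) blast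
      next
        fix p assume p: "p \<in> F"
        obtain n k where nk: "p = (n, k)" by (cases p)
        obtain s where s: "s \<in> cspan_l2 ((\<lambda>z. tfs z h) ` lattice_box v w (a * n + b * k) (c * n + d * k) (real R))"
          "norm (tfs (pt p) u - s) < \<eta> * \<delta>"
          using R[of "a * n + b * k" "c * n + d * k"] unfolding nk pt by blast
        have "lattice_box v w (a * n + b * k) (c * n + d * k) (real R) \<subseteq> lattice_box v w 0 0 (real N)"
        proof -
          have "\<bar>of_int m - 0\<bar> \<le> real N" if "\<bar>of_int m - x\<bar> \<le> real R" "\<bar>x\<bar> \<le> real N - real R" for m :: int and x :: real
            using that by linarith
          then show ?thesis using p unfolding nk F_def lattice_box_def by fastforce
        qed
        then have "s \<in> cspan_l2 B"
          using s(1) unfolding B_def by (rule subsetD[OF cspan_l2_mono[OF image_mono]])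
        then show "\<exists>y\<in>cspan_l2 B. norm (tfs (pt p) u - y) \<le> \<eta> * \<delta>"
          using s(2) by (intro bexI[of _ s]) auto
      qed
      moreover have "real (card B) \<le> (2 * real N + 1)\<^sup>2"
        using of_nat_mono[OF B(2), where 'a = real] by (simp add: add.commute)
      ultimately have "real (card F) * (1 - \<eta>) \<le> (2 * real N + 1)\<^sup>2"
        using \<open>\<delta> > 0\<close> by simp
      moreover have "4 * (real N - R - C)\<^sup>2 / \<bar>D\<bar> * (1 - \<eta>) \<le> real (card F) * (1 - \<eta>)"
        using F(2) \<open>D \<noteq> 0\<close> \<eta> by (intro mult_right_mono) (auto simp: divide_simps mult.commute)
      ultimately show "4 * (real N - (real R + C))\<^sup>2 * ((1 - \<eta>) / \<bar>D\<bar>) \<le> (2 * real N + 1)\<^sup>2"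
        by (simp add: diff_diff_eq)
    qed
  qed
  have "1 \<le> \<bar>D\<bar>"
  proof (rule ccontr)
    assume "\<not> 1 \<le> \<bar>D\<bar>"
    then have D1: "0 < \<bar>D\<bar>" "\<bar>D\<bar> < 1" using \<open>D \<noteq> 0\<close> by auto
    \<comment> \<open>With this \<eta> the number \<open>1 - \<eta>\<close> is the midpoint of
      \<open>\<bar>D\<bar>\<close> and 1, so it cannot be at most
      \<open>\<bar>D\<bar>\<close>.\<close>
    then have "(1 - (1 - \<bar>D\<bar>) / 2) / \<bar>D\<bar> \<le> 1" by (intro main) auto
    then have "1 - (1 - \<bar>D\<bar>) / 2 \<le> \<bar>D\<bar>" using D1 by (simp only: pos_divide_le_eq mult_1_left)
    then show False using D1(2) by (simp add: field_simps)
  qed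
  then show ?thesis using det by (simp add: D field_simps)
qed

section \<open>The reference system: integer shifts of the indicator of the unit interval\<close>

text \<open>With the half-open interval the integer translates partition the line, and the floor
  turns membership into an equation.\<close>

definition chi :: "real \<Rightarrow> complex" where
  "chi t = (if \<lfloor>t\<rfloor> = 0 then 1 else 0)"

text \<open>Density is proved on each interval between consecutive integers separately; there
  bounded functions are square-integrable and the exponentials of the system are periodic.\<close>

definition window :: "int \<Rightarrow> (real \<Rightarrow> complex) \<Rightarrow> real \<Rightarrow> complex" where
  "window n f t = (if \<lfloor>t\<rfloor> = n then f t else 0)"

lemma measurable_window [measurable]: "f \<in> borel_measurable borel \<Longrightarrow> window n f \<in> borel_measurable borel"
proof -
  have "window n f = (\<lambda>t. indicator {of_int n..<of_int n + 1} t * f t)" for n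
    by (auto simp: window_def fun_eq_iff indicator_def floor_eq_iff)
  then show "f \<in> borel_measurable borel \<Longrightarrow> window n f \<in> borel_measurable borel"
    by simp
qed

lemma chi_eq_window: "chi = window 0 (\<lambda>t. 1)"
  by (simp add: chi_def window_def fun_eq_iff)

lemma cmod_window_le: "cmod (window n f t) \<le> cmod (f t)"
  by (simp add: window_def)

lemma integrable_square_window: "integrable lborel (\<lambda>t::real. (if \<lfloor>t\<rfloor> = n then B else 0 :: real)\<^sup>2)"
proof -
  have "(\<lambda>t::real. (if \<lfloor>t\<rfloor> = n then B else 0)\<^sup>2) = (\<lambda>t. B\<^sup>2 * indicator {of_int n..<of_int n + 1} t)"
    by (auto simp: fun_eq_iff indicator_def floor_eq_iff)
  then show ?thesis by (simp only:) simp
qed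

lemma L2_window: "f \<in> L2 \<Longrightarrow> window n f \<in> L2"
  by (rule L2_bound[where G = "\<lambda>t. cmod (f t)"]) (auto simp: L2_iff cmod_window_le)

lemma L2_window_bounded:
  assumes "f \<in> borel_measurable borel" "\<And>t. cmod (f t) \<le> B"
  shows "window n f \<in> L2"
  by (rule L2_bound[OF _ integrable_square_window[of n B]]) (use assms in \<open>auto simp: window_def\<close>)

lemma L2_chi: "chi \<in> L2"
  unfolding chi_eq_window by (rule L2_window_bounded[where B = 1]) auto

abbreviation chi_sys :: "real \<times> real \<Rightarrow> l2" where
  "chi_sys z \<equiv> tfs z (abs_l2 chi)"

lemma chi_sys_int: "chi_sys (of_int n, of_int k) = abs_l2 (window n (\<lambda>t. cis (2 * pi * of_int k * t)))"
proof -
  have "\<lfloor>t - of_int n\<rfloor> = 0 \<longleftrightarrow> \<lfloor>t\<rfloor> = n" for t :: real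
    by simp
  then have "tf_shift chi (of_int n, of_int k) = window n (\<lambda>t. cis (2 * pi * of_int k * t))"
    unfolding tf_shift_def window_def chi_def fun_eq_iff by auto
  then show ?thesis by (simp add: tfs_abs_l2 L2_chi)
qed

lemma mem_int_lattice: "z \<in> lattice (1, 0) (0, 1) \<longleftrightarrow> (\<exists>n k. z = (of_int n, of_int k))"
  by (simp add: lattice_def)

definition chi_span :: "l2 set" where
  "chi_span = closure (cspan_l2 (chi_sys ` lattice (1, 0) (0, 1)))"

lemma subspace_closure:
  fixes S :: "'a::real_normed_vector set"
  assumes "subspace S"
  shows "subspace (closure S)"
proof (rule subspaceI)
  show "0 \<in> closure S"
    using subspace_0[OF assms] closure_subset by blast
  fix x y assume "x \<in> closure S" "y \<in> closure S"
  then obtain f g where "\<forall>n. f n \<in> S" "f \<longlonglongrightarrow> x" "\<forall>n. g n \<in> S" "g \<longlonglongrightarrow> y"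
    unfolding closure_sequential by blast
  then show "x + y \<in> closure S"
    unfolding closure_sequential
    by (intro exI[of _ "\<lambda>n. f n + g n"]) (auto intro: tendsto_add subspace_add[OF assms])
next
  fix r x assume "x \<in> closure S"
  then obtain f where "\<forall>n. f n \<in> S" "f \<longlonglongrightarrow> x"
    unfolding closure_sequential by blast
  then show "r *\<^sub>R x \<in> closure S"
    unfolding closure_sequential
    by (intro exI[of _ "\<lambda>n. r *\<^sub>R f n"]) (auto intro: tendsto_scaleR subspace_scale[OF assms])
qed

lemma closed_chi_span: "closed chi_span" and subspace_chi_span: "subspace chi_span"
  unfolding chi_span_def by (auto intro: subspace_closure subspace_cspan_l2)

lemma bounded_linear_cscale: "bounded_linear (cscale c)"
  by (rule bounded_linear_intro[where K = "cmod c"])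
    (auto simp: linear_add[OF linear_cscale] linear_scale[OF linear_cscale] norm_cscale mult.commute)

lemma cscale_chi_span:
  assumes "x \<in> chi_span"
  shows "cscale c x \<in> chi_span"
proof -
  have "cscale c ` closure (cspan_l2 (chi_sys ` lattice (1, 0) (0, 1))) \<subseteq> chi_span"
    by (rule image_closure_subset[OF linear_continuous_on[OF bounded_linear_cscale] closed_chi_span])
      (auto simp: chi_span_def intro: cscale_cspan_l2 subsetD[OF closure_subset])
  then show ?thesis using assms unfolding chi_span_def by blast
qed

lemma window_exp_chi_span: "abs_l2 (window n (\<lambda>t. cis (2 * pi * of_int k * t))) \<in> chi_span"
proof -
  have "cscale 1 (chi_sys (of_int n, of_int k)) \<in> cspan_l2 (chi_sys ` lattice (1, 0) (0, 1))"
    by (intro cspan_l2_base imageI) (auto simp: mem_int_lattice)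
  then show ?thesis
    unfolding chi_span_def by (auto simp: cscale_one chi_sys_int intro: subsetD[OF closure_subset])
qed

section \<open>Density of trigonometric polynomials on a unit interval\<close>

inductive_set trig_poly :: "(real \<Rightarrow> complex) set" where
  exp: "(\<lambda>t. cis (2 * pi * of_int k * t)) \<in> trig_poly"
| add: "p \<in> trig_poly \<Longrightarrow> q \<in> trig_poly \<Longrightarrow> (\<lambda>t. p t + q t) \<in> trig_poly"
| cmult: "p \<in> trig_poly \<Longrightarrow> (\<lambda>t. c * p t) \<in> trig_poly"

lemma trig_poly_mult:
  assumes "p \<in> trig_poly" "q \<in> trig_poly"
  shows "(\<lambda>t. p t * q t) \<in> trig_poly"
  using assms(1)
proof induction
  case (exp k)
  show ?case using assms(2)
  proof induction
    case (exp l)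
    have "(\<lambda>t. cis (2 * pi * of_int k * t) * cis (2 * pi * of_int l * t)) = (\<lambda>t. cis (2 * pi * of_int (k + l) * t))"
      by (simp add: cis_mult algebra_simps)
    then show ?case by (simp only: trig_poly.exp)
  next
    case (add p q)
    show ?case unfolding distrib_left using add.IH by (rule trig_poly.add)
  next
    case (cmult p c)
    show ?case unfolding mult.left_commute[of _ c] using cmult.IH by (rule trig_poly.cmult)
  qed
next
  case (add p q)
  show ?case unfolding distrib_right using add.IH by (rule trig_poly.add)
next
  case (cmult p c)
  show ?case unfolding mult.assoc using cmult.IH by (rule trig_poly.cmult)
qed

text \<open>Links Stone-Weierstrass on the circle to exponentials: real polynomial functions are
  generated by linear functionals, and on the circle such a functional is a combination of cosine
  and sine.\<close>

lemma trig_poly_real_polynomial: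
  fixes g :: "complex \<Rightarrow> real"
  assumes "real_polynomial_function g"
  shows "(\<lambda>t. of_real (g (cis (2 * pi * t)))) \<in> trig_poly"
  using assms
proof induction
  case (linear g)
  \<comment> \<open>From Euler's formulas applied to \<open>g 1\<close> times the cosine plus
    \<open>g \<i>\<close> times the sine.\<close>
  define c1 c2 where "c1 = Complex (g 1 / 2) (- g \<i> / 2)" and "c2 = Complex (g 1 / 2) (g \<i> / 2)"
  have "of_real (g (cis (2 * pi * t))) = c1 * cis (2 * pi * of_int 1 * t) + c2 * cis (2 * pi * of_int (- 1) * t)" for t
  proof -
    have "cis (2 * pi * t) = cos (2 * pi * t) *\<^sub>R 1 + sin (2 * pi * t) *\<^sub>R \<i>"
      by (simp add: complex_eq_iff)
    then have "g (cis (2 * pi * t)) = cos (2 * pi * t) * g 1 + sin (2 * pi * t) * g \<i>"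
      using bounded_linear.linear[OF linear] by (simp only: linear_add linear_scale real_scaleR_def)
    then show ?thesis
      by (simp add: c1_def c2_def complex_eq_iff algebra_simps)
  qed
  then show ?case
    by (simp only:) (intro trig_poly.add trig_poly.cmult trig_poly.exp)
next
  case (const c)
  show ?case
    using trig_poly.cmult[OF trig_poly.exp[of 0], of "of_real c"] by simp
next
  case (add f g)
  show ?case unfolding of_real_add using add.IH by (rule trig_poly.add)
next
  case (mult f g)
  show ?case unfolding of_real_mult using mult.IH by (rule trig_poly_mult)
qed

lemma window_trig_poly_chi_span:
  assumes "p \<in> trig_poly"
  shows "p \<in> borel_measurable borel" "\<exists>B. \<forall>t. cmod (p t) \<le> B" "abs_l2 (window n p) \<in> chi_span"
proof -
  have "p \<in> borel_measurable borel \<and> (\<exists>B. \<forall>t. cmod (p t) \<le> B) \<and> abs_l2 (window n p) \<in> chi_span"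
    using assms
  proof induction
    case (exp k)
    then show ?case using window_exp_chi_span by (auto intro!: exI[of _ 1])
  next
    case (add p q)
    then obtain B1 B2 where B: "\<And>t. cmod (p t) \<le> B1" "\<And>t. cmod (q t) \<le> B2" by blast
    have "window n (\<lambda>t. p t + q t) = (\<lambda>t. window n p t + window n q t)"
      by (auto simp: window_def)
    moreover have "window n p \<in> L2" "window n q \<in> L2"
      using add.IH L2_window_bounded[OF _ B(1)] L2_window_bounded[OF _ B(2)] by auto
    ultimately have "abs_l2 (window n (\<lambda>t. p t + q t)) = abs_l2 (window n p) + abs_l2 (window n q)"
      by (simp add: abs_l2_add)
    then have "abs_l2 (window n (\<lambda>t. p t + q t)) \<in> chi_span"
      using add by (auto intro: subspace_add[OF subspace_chi_span])
    moreover have "cmod (p t + q t) \<le> B1 + B2" for t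
      using B norm_triangle_mono by blast
    ultimately show ?case using add by auto
  next
    case (cmult p c)
    then obtain B where B: "\<And>t. cmod (p t) \<le> B" by blast
    have "window n (\<lambda>t. c * p t) = (\<lambda>t. c * window n p t)"
      by (auto simp: window_def)
    moreover have "window n p \<in> L2"
      using cmult.IH L2_window_bounded[OF _ B] by auto
    ultimately have "abs_l2 (window n (\<lambda>t. c * p t)) = cscale c (abs_l2 (window n p))"
      by (simp add: cscale_abs_l2)
    then have "abs_l2 (window n (\<lambda>t. c * p t)) \<in> chi_span"
      using cmult by (auto intro: cscale_chi_span)
    moreover have "cmod (c * p t) \<le> cmod c * B" for t
      using B by (simp add: norm_mult mult_left_mono)
    ultimately show ?case using cmult by auto
  qed
  then show "p \<in> borel_measurable borel" "\<exists>B. \<forall>t. cmod (p t) \<le> B" "abs_l2 (window n p) \<in> chi_span"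
    by auto
qed

text \<open>A constant is square-integrable on one window, so bounded pointwise limits stay in the
  closed span. The passages to continuous functions, closed sets and countable unions all go through
  this.\<close>

lemma window_limit_chi_span:
  assumes "\<And>m. f m \<in> borel_measurable borel" "h \<in> borel_measurable borel"
    and "\<And>m t. cmod (f m t) \<le> B" "\<And>t. (\<lambda>m. f m t) \<longlonglongrightarrow> h t"
    and "\<And>m. abs_l2 (window n (f m)) \<in> chi_span"
  shows "abs_l2 (window n h) \<in> chi_span"
proof (rule closed_sequentially[OF closed_chi_span assms(5)])
  show "(\<lambda>m. abs_l2 (window n (f m))) \<longlonglongrightarrow> abs_l2 (window n h)"
    by (rule abs_l2_tendsto_dominated(2)[OF _ _ integrable_square_window[of n B]])
      (use assms in \<open>auto simp: window_def\<close>)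
qed

lemma window_continuous_chi_span:
  fixes G :: "complex \<Rightarrow> real"
  assumes "continuous_on UNIV G"
  shows "abs_l2 (window n (\<lambda>t. of_real (G (cis (2 * pi * t))))) \<in> chi_span"
proof -
  have cont: "continuous_on (sphere 0 1) G" using assms continuous_on_subset by blast
  have "\<exists>g. real_polynomial_function g \<and> (\<forall>z\<in>sphere 0 1. \<bar>G z - g z\<bar> < 1 / real (Suc m))" for m
  proof -
    have "0 < 1 / real (Suc m)" by simp
    then obtain g where "real_polynomial_function g" "\<And>z. z \<in> sphere 0 1 \<Longrightarrow> \<bar>G z - g z\<bar> < 1 / real (Suc m)"
      by (rule Stone_Weierstrass_real_polynomial_function[OF compact_sphere cont]) (rule that)
    then show ?thesis by blast
  qed
  then obtain g where g: "\<And>m. real_polynomial_function (g m)"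
    "\<And>m z. z \<in> sphere 0 1 \<Longrightarrow> \<bar>G z - g m z\<bar> < 1 / real (Suc m)"
    by metis
  have "bounded (G ` sphere 0 1)"
    using compact_imp_bounded[OF compact_continuous_image[OF cont compact_sphere]] .
  then obtain B where "\<forall>y\<in>G ` sphere 0 1. norm y \<le> B"
    unfolding bounded_iff by blast
  then have B: "\<bar>G z\<bar> \<le> B" if "z \<in> sphere 0 1" for z
    using that by simp
  have cis: "cis (2 * pi * t) \<in> sphere 0 1" for t by simp
  show ?thesis
  proof (rule window_limit_chi_span[where B = "B + 1"])
    fix m t
    show "(\<lambda>t. complex_of_real (g m (cis (2 * pi * t)))) \<in> borel_measurable borel"
      "abs_l2 (window n (\<lambda>t. of_real (g m (cis (2 * pi * t))))) \<in> chi_span"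
      using window_trig_poly_chi_span[OF trig_poly_real_polynomial[OF g(1)]] by auto
    have "1 / real (Suc m) \<le> 1" by simp
    then have "\<bar>g m (cis (2 * pi * t))\<bar> \<le> B + 1"
      using g(2)[OF cis, of t m] B[OF cis, of t] by linarith
    then show "cmod (of_real (g m (cis (2 * pi * t)))) \<le> B + 1" by simp
  next
    have [measurable]: "G \<in> borel_measurable borel"
      using assms by (rule borel_measurable_continuous_onI)
    show "(\<lambda>t. complex_of_real (G (cis (2 * pi * t)))) \<in> borel_measurable borel"
      by measurable
  next
    fix t
    have "(\<lambda>m. g m (cis (2 * pi * t)) - G (cis (2 * pi * t))) \<longlonglongrightarrow> 0"
      by (rule Lim_null_comparison[OF _ LIMSEQ_Suc[OF lim_1_over_n]])
        (use g(2)[OF cis, of t] in \<open>auto simp: abs_minus_commute less_imp_le\<close>)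
    then have "(\<lambda>m. g m (cis (2 * pi * t))) \<longlonglongrightarrow> G (cis (2 * pi * t))"
      by (rule LIM_zero_cancel)
    then show "(\<lambda>m. complex_of_real (g m (cis (2 * pi * t)))) \<longlonglongrightarrow> of_real (G (cis (2 * pi * t)))"
      by (rule tendsto_of_real)
  qed
qed

text \<open>The continuous functions \<open>G m\<close> decrease to the indicator of
  \<open>C\<close>: they are 1 on \<open>C\<close> and vanish at distance at least
  \<open>1 / m\<close> from it when \<open>m > 0\<close>.\<close>

lemma window_closed_chi_span:
  assumes "closed C" "C \<noteq> {}"
  shows "abs_l2 (window n (\<lambda>t. indicator C (cis (2 * pi * t)))) \<in> chi_span"
proof -
  define G :: "nat \<Rightarrow> complex \<Rightarrow> real" where "G m z = max 0 (1 - real m * infdist z C)" for m z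
  have G_cont: "continuous_on UNIV (G m)" for m
    unfolding G_def by (intro continuous_intros)
  show ?thesis
  proof (rule window_limit_chi_span[where B = 1])
    fix m t
    show "abs_l2 (window n (\<lambda>t. of_real (G m (cis (2 * pi * t))))) \<in> chi_span"
      by (rule window_continuous_chi_span[OF G_cont])
    have [measurable]: "G m \<in> borel_measurable borel"
      using G_cont by (rule borel_measurable_continuous_onI)
    show "(\<lambda>t. complex_of_real (G m (cis (2 * pi * t)))) \<in> borel_measurable borel"
      by measurable
    have "0 \<le> G m (cis (2 * pi * t))" "G m (cis (2 * pi * t)) \<le> 1"
      using infdist_nonneg[of "cis (2 * pi * t)" C] by (auto simp: G_def)
    then show "cmod (of_real (G m (cis (2 * pi * t)))) \<le> 1" by simp
  next
    have [measurable]: "C \<in> sets borel" using assms by simp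
    show "(\<lambda>t. indicator C (cis (2 * pi * t)) :: complex) \<in> borel_measurable borel"
      by measurable
  next
    fix t
    define z where "z = cis (2 * pi * t)"
    have "(\<lambda>m. G m z) \<longlonglongrightarrow> indicator C z"
    proof (cases "z \<in> C")
      case True
      then show ?thesis by (simp add: G_def)
    next
      case False
      then have pos: "infdist z C > 0"
        using assms by (simp add: infdist_pos_not_in_closed)
      obtain M where M: "real M > 1 / infdist z C" using reals_Archimedean2 by blast
      have "G m z = 0" if "m \<ge> M" for m
      proof -
        have "real m * infdist z C \<ge> real M * infdist z C"
          using that pos by (intro mult_right_mono) auto
        moreover have "real M * infdist z C > 1" using M pos by (simp add: divide_less_eq)
        ultimately show ?thesis by (simp add: G_def)
      qed
      then have "eventually (\<lambda>m. G m z = indicator C z) sequentially"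
        using False by (auto simp: eventually_sequentially)
      then show ?thesis by (rule tendsto_eventually)
    qed
    then have "(\<lambda>m. complex_of_real (G m z)) \<longlonglongrightarrow> of_real (indicator C z)"
      by (rule tendsto_of_real)
    moreover have "complex_of_real (indicator C z) = indicator C z"
      by (simp add: indicator_def)
    ultimately show "(\<lambda>m. complex_of_real (G m (cis (2 * pi * t)))) \<longlonglongrightarrow> indicator C (cis (2 * pi * t))"
      by (simp only: z_def)
  qed
qed

text \<open>Inside the window a half-line that meets it corresponds to a closed arc of the circle,
  which reduces the claim to closed sets.\<close>

lemma window_atMost_chi_span: "abs_l2 (window n (indicator {..a})) \<in> chi_span"
proof (cases "a < of_int n")
  case True
  then have "window n (indicator {..a}) = (\<lambda>t. 0)"
    by (auto simp: window_def fun_eq_iff indicator_def floor_eq_iff)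
  then show ?thesis
    by (simp add: abs_l2_zero subspace_0[OF subspace_chi_span])
next
  case False
  \<comment> \<open>For \<open>a\<close> at or beyond the right end of the window the arc is the
    whole circle, where \<open>n\<close> and \<open>n + 1\<close> are identified.\<close>
  define S where "S = {of_int n..min a (of_int n + 1)}"
  define C where "C = (\<lambda>t. cis (2 * pi * t)) ` S"
  have "of_int n \<in> S" using False by (auto simp: S_def)
  then have "C \<noteq> {}" by (auto simp: C_def)
  moreover have "compact C"
    unfolding C_def S_def by (intro compact_continuous_image continuous_intros) auto
  moreover have "window n (\<lambda>t. indicator C (cis (2 * pi * t))) = window n (indicator {..a})"
  proof
    fix t
    have "cis (2 * pi * t) \<in> C \<longleftrightarrow> t \<le> a" if t: "of_int n \<le> t" "t < of_int n + 1"
    proof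
      assume "t \<le> a"
      then show "cis (2 * pi * t) \<in> C" using t by (auto simp: C_def S_def)
    next
      assume "cis (2 * pi * t) \<in> C"
      then obtain s where s: "s \<in> S" "cis (2 * pi * t) = cis (2 * pi * s)" by (auto simp: C_def)
      then obtain k :: int where "2 * pi * t = 2 * pi * s + 2 * pi * k"
        using sin_cos_eq_iff[of "2 * pi * t" "2 * pi * s"] by (auto simp: complex_eq_iff)
      then have "2 * pi * t = 2 * pi * (s + k)" by (simp add: algebra_simps)
      then have k: "t = s + k" by simp
      \<comment> \<open>Preimages on the circle are unique up to an integer \<open>k\<close>. As
        \<open>s\<close> is at least \<open>n\<close> and \<open>t\<close> is below
        \<open>n + 1\<close>, only \<open>k \<le> 0\<close> remains, and then
        \<open>t \<le> s \<le> a\<close>.\<close>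
      then have "real_of_int k < 1" using s(1) t by (auto simp: S_def)
      then have "k \<le> 0" by simp
      then show "t \<le> a" using k s(1) by (auto simp: S_def)
    qed
    then show "window n (\<lambda>t. indicator C (cis (2 * pi * t))) t = window n (indicator {..a}) t"
      by (auto simp: window_def indicator_def floor_eq_iff)
  qed
  ultimately show ?thesis
    using window_closed_chi_span[of C n] by (simp add: compact_imp_closed)
qed

text \<open>Dynkin's argument: closed half-lines form an intersection-stable generator of the Borel
  sets, and the good sets form a Dynkin system. Complements use the constant 1, the exponential of
  frequency 0.\<close>

lemma window_indicator_chi_span:
  assumes "A \<in> sets (borel :: real measure)"
  shows "abs_l2 (window n (indicator A)) \<in> chi_span"
proof -
  have L2_ind: "window n (indicator A) \<in> L2" if "A \<in> sets borel" for A
    using that by (intro L2_window_bounded[where B = 1]) (auto simp: indicator_def)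
  let ?G = "range (\<lambda>a::real. {..a})"
  have sigma: "sigma_sets UNIV ?G = sets borel"
    by (simp add: borel_eq_atMost)
  have "Int_stable ?G"
    by (auto simp: Int_stable_def)
  moreover have "A \<in> sigma_sets UNIV ?G" using assms sigma by simp
  ultimately show ?thesis
  proof (induction rule: sigma_sets_induct_disjoint[OF _ subset_Pow_Union[THEN order.trans[OF _ Pow_mono[OF subset_UNIV]]], consumes 2, case_names basic empty compl union])
    case (basic A)
    then show ?case using window_atMost_chi_span by auto
  next
    case empty
    have "window n (\<lambda>t. 0) = (\<lambda>t. 0)" by (simp add: window_def fun_eq_iff)
    then show ?case by (simp add: abs_l2_zero subspace_0[OF subspace_chi_span])
  next
    case (compl A)
    then have A: "A \<in> sets borel" by (simp add: sigma)
    have one: "window n (\<lambda>t. 1) \<in> L2" "abs_l2 (window n (\<lambda>t. 1)) \<in> chi_span"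
      using window_exp_chi_span[of n 0] by (auto intro: L2_window_bounded[where B = 1])
    have "window n (indicator (UNIV - A)) = (\<lambda>t. window n (\<lambda>t. 1) t - window n (indicator A) t)"
      by (auto simp: window_def fun_eq_iff indicator_def)
    then have "abs_l2 (window n (indicator (UNIV - A))) = abs_l2 (window n (\<lambda>t. 1)) - abs_l2 (window n (indicator A))"
      using one A by (simp only: abs_l2_diff L2_ind)
    then show ?case
      using one compl by (auto intro: subspace_diff[OF subspace_chi_span])
  next
    case (union A)
    then have A: "A i \<in> sets borel" for i by (auto simp: sigma)
    show ?case
    proof (rule window_limit_chi_span[where B = 1])
      fix m :: nat and t :: real
      have "abs_l2 (window n (indicator (\<Union>i<m. A i))) = (\<Sum>i<m. abs_l2 (window n (indicator (A i))))"
      proof -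
        have "window n (indicator (\<Union>i<m. A i)) = (\<lambda>t. \<Sum>i<m. window n (indicator (A i)) t)"
        proof
          fix t
          have "disjoint_family_on A {..<m}"
            using union(1) by (rule disjoint_family_on_mono[rotated]) simp
          then have "indicator (\<Union>i<m. A i) t = (\<Sum>i<m. indicator (A i) t :: complex)"
            by (intro indicator_UN_disjoint) auto
          then show "window n (indicator (\<Union>i<m. A i)) t = (\<Sum>i<m. window n (indicator (A i)) t)"
            by (simp add: window_def)
        qed
        then show ?thesis by (simp add: abs_l2_sum L2_ind A)
      qed
      then show "abs_l2 (window n (indicator (\<Union>i<m. A i))) \<in> chi_span"
        using union(3) by (simp add: subspace_sum[OF subspace_chi_span])
      show "cmod (indicator (\<Union>i<m. A i) t) \<le> 1"
        by (simp add: indicator_def)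
      show "(\<lambda>m. indicator (\<Union>i<m. A i) t :: complex) \<longlonglongrightarrow> indicator (\<Union>i. A i) t"
        by (rule LIMSEQ_indicator_UN)
    qed (use A in \<open>auto intro!: borel_measurable_indicator\<close>)
  qed
qed

text \<open>The induction over nonnegative Borel functions does not know that its functions are
  square-integrable on the window, so this becomes a premise of the claim. \<open>smaller\<close>
  recovers it for summands and monotone approximants.\<close>

lemma window_nonneg_chi_span:
  fixes u :: "real \<Rightarrow> real"
  assumes "u \<in> borel_measurable borel" "\<And>x. 0 \<le> u x" "window n (\<lambda>t. of_real (u t)) \<in> L2"
  shows "abs_l2 (window n (\<lambda>t. of_real (u t))) \<in> chi_span"
proof -
  have smaller: "window n (\<lambda>t. of_real (v t)) \<in> L2"
    if "window n (\<lambda>t. of_real (u t)) \<in> L2" "v \<in> borel_measurable borel" "\<And>t. 0 \<le> v t" "\<And>t. v t \<le> u t"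
    for u v :: "real \<Rightarrow> real"
  proof (rule L2_bound)
    show "integrable lborel (\<lambda>t. (cmod (window n (\<lambda>t. of_real (u t)) t))\<^sup>2)"
      using that(1) by (simp add: L2_iff)
    show "window n (\<lambda>t. complex_of_real (v t)) \<in> borel_measurable borel"
      using that(2) by measurable
    show "AE t in lborel. cmod (window n (\<lambda>t. of_real (v t)) t) \<le> cmod (window n (\<lambda>t. of_real (u t)) t)"
      using that(3,4) order.trans[OF that(3,4)] by (auto simp: window_def)
  qed
  have "window n (\<lambda>t. of_real (u t)) \<in> L2 \<longrightarrow> abs_l2 (window n (\<lambda>t. of_real (u t))) \<in> chi_span"
    using assms(1,2)
  proof (induction rule: borel_measurable_induct_real)
    case (set A)
    have "(\<lambda>t. complex_of_real (indicator A t)) = indicator A"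
      by (auto simp: indicator_def)
    then show ?case
      using window_indicator_chi_span[of A n] set by simp
  next
    case (mult u c)
    have eq: "window n (\<lambda>t. complex_of_real (c * u t)) = (\<lambda>t. of_real c * window n (\<lambda>t. of_real (u t)) t)"
      by (auto simp: window_def)
    show ?case
    \<comment> \<open>For \<open>c = 0\<close> square-integrability of the product says nothing
      about \<open>u\<close>, but then the product is zero.\<close>
    proof (cases "c = 0")
      case True
      then show ?thesis
        unfolding eq by (simp add: abs_l2_zero subspace_0[OF subspace_chi_span])
    next
      case False
      show ?thesis
      proof
        assume "window n (\<lambda>t. complex_of_real (c * u t)) \<in> L2"
        from L2_cmult[OF this, of "of_real (1 / c)"] have L2: "window n (\<lambda>t. complex_of_real (u t)) \<in> L2"
          unfolding eq using False by simp
        then show "abs_l2 (window n (\<lambda>t. complex_of_real (c * u t))) \<in> chi_span"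
          unfolding eq using mult(4) by (simp add: abs_l2_scaleR subspace_scale[OF subspace_chi_span])
      qed
    qed
  next
    case (add u v)
    show ?case
    proof
      assume *: "window n (\<lambda>t. complex_of_real (v t + u t)) \<in> L2"
      have L2: "window n (\<lambda>t. complex_of_real (u t)) \<in> L2" "window n (\<lambda>t. complex_of_real (v t)) \<in> L2"
        by (rule smaller[OF *]; use add in simp)+
      have "window n (\<lambda>t. complex_of_real (v t + u t)) =
          (\<lambda>t. window n (\<lambda>t. of_real (v t)) t + window n (\<lambda>t. of_real (u t)) t)"
        by (auto simp: window_def)
      then show "abs_l2 (window n (\<lambda>t. complex_of_real (v t + u t))) \<in> chi_span"
        using L2 add by (simp add: abs_l2_add subspace_add[OF subspace_chi_span])
    qed
  next
    case (seq U)
    have U [measurable]: "\<And>i. U i \<in> borel_measurable borel" and nonneg: "\<And>i x. 0 \<le> U i x"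
      and inc: "incseq U" and lim: "\<And>x. (\<lambda>i. U i x) \<longlonglongrightarrow> u x"
      and IH: "\<And>i. window n (\<lambda>t. of_real (U i t)) \<in> L2 \<Longrightarrow> abs_l2 (window n (\<lambda>t. of_real (U i t))) \<in> chi_span"
      using seq by auto
    have [measurable]: "u \<in> borel_measurable borel"
      using borel_measurable_LIMSEQ_real[OF lim U] by simp
    show ?case
    proof
      assume *: "window n (\<lambda>t. complex_of_real (u t)) \<in> L2"
      have le: "U i t \<le> u t" for i t
        using inc lim by (intro incseq_le[of "\<lambda>i. U i t"]) (auto simp: incseq_def le_fun_def)
      have "window n (\<lambda>t. complex_of_real (U i t)) \<in> L2" for i
        by (rule smaller[OF *]) (use nonneg le in auto)
      then have "abs_l2 (window n (\<lambda>t. complex_of_real (U i t))) \<in> chi_span" for i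
        by (rule IH)
      then show "abs_l2 (window n (\<lambda>t. complex_of_real (u t))) \<in> chi_span"
      proof (rule closed_sequentially[OF closed_chi_span])
        show "(\<lambda>i. abs_l2 (window n (\<lambda>t. complex_of_real (U i t)))) \<longlonglongrightarrow> abs_l2 (window n (\<lambda>t. complex_of_real (u t)))"
        proof (rule abs_l2_tendsto_dominated(2))
          show "integrable lborel (\<lambda>t. (cmod (window n (\<lambda>t. of_real (u t)) t))\<^sup>2)"
            using * by (simp add: L2_iff)
          show "AE t in lborel. cmod (window n (\<lambda>t. of_real (U i t)) t) \<le> cmod (window n (\<lambda>t. of_real (u t)) t)" for i
            using nonneg[of i] le[of i] order.trans[OF nonneg[of i] le[of i]] by (auto simp: window_def)
          show "AE t in lborel. (\<lambda>i. window n (\<lambda>t. complex_of_real (U i t)) t) \<longlonglongrightarrow> window n (\<lambda>t. of_real (u t)) t"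
            using lim by (auto simp: window_def intro!: tendsto_of_real)
        qed measurable
      qed
    qed
  qed
  then show ?thesis using assms(3) by simp
qed

lemma window_L2_chi_span:
  assumes "f \<in> L2"
  shows "abs_l2 (window n f) \<in> chi_span"
proof -
  note [measurable] = L2_measurable[OF assms]
  have part: "window n (\<lambda>t. of_real (u t)) \<in> L2" "abs_l2 (window n (\<lambda>t. of_real (u t))) \<in> chi_span"
    if [measurable]: "u \<in> borel_measurable borel" and u: "\<And>t. \<bar>u t\<bar> \<le> cmod (f t)" "\<And>t. 0 \<le> u t" for u
  proof -
    show "window n (\<lambda>t. of_real (u t)) \<in> L2"
      by (rule L2_bound[where G = "\<lambda>t. cmod (f t)"]) (use assms u in \<open>auto simp: L2_iff window_def\<close>)
    then show "abs_l2 (window n (\<lambda>t. of_real (u t))) \<in> chi_span"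
      using u by (intro window_nonneg_chi_span) auto
  qed
  have real: "window n (\<lambda>t. of_real (u t)) \<in> L2" "abs_l2 (window n (\<lambda>t. of_real (u t))) \<in> chi_span"
    if [measurable]: "u \<in> borel_measurable borel" and u: "\<And>t. \<bar>u t\<bar> \<le> cmod (f t)" for u
  proof -
    have p: "window n (\<lambda>t. of_real (max 0 (u t))) \<in> L2" "abs_l2 (window n (\<lambda>t. of_real (max 0 (u t)))) \<in> chi_span"
      using order.trans[OF abs_ge_zero u] u by (intro part; auto simp: abs_le_iff max_def)+
    have m: "window n (\<lambda>t. of_real (max 0 (- u t))) \<in> L2" "abs_l2 (window n (\<lambda>t. of_real (max 0 (- u t)))) \<in> chi_span"
      using order.trans[OF abs_ge_zero u] u by (intro part; auto simp: abs_le_iff max_def)+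
    have "window n (\<lambda>t. complex_of_real (u t)) =
        (\<lambda>t. window n (\<lambda>t. of_real (max 0 (u t))) t - window n (\<lambda>t. of_real (max 0 (- u t))) t)"
      by (auto simp: window_def max_def)
    then show "window n (\<lambda>t. of_real (u t)) \<in> L2" "abs_l2 (window n (\<lambda>t. of_real (u t))) \<in> chi_span"
      using p m by (simp_all add: abs_l2_diff L2_diff subspace_diff[OF subspace_chi_span])
  qed
  have re: "window n (\<lambda>t. of_real (Re (f t))) \<in> L2" "abs_l2 (window n (\<lambda>t. of_real (Re (f t)))) \<in> chi_span"
    and im: "window n (\<lambda>t. of_real (Im (f t))) \<in> L2" "abs_l2 (window n (\<lambda>t. of_real (Im (f t)))) \<in> chi_span"
    by (rule real; use abs_Re_le_cmod abs_Im_le_cmod in simp)+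
  have "window n f = (\<lambda>t. window n (\<lambda>t. of_real (Re (f t))) t + \<i> * window n (\<lambda>t. of_real (Im (f t))) t)"
    by (auto simp: window_def fun_eq_iff complex_eq)
  then have "abs_l2 (window n f) = abs_l2 (window n (\<lambda>t. of_real (Re (f t)))) + cscale \<i> (abs_l2 (window n (\<lambda>t. of_real (Im (f t)))))"
    using re im by (simp add: abs_l2_add cscale_abs_l2 L2_cmult)
  then show ?thesis
    using re im by (simp add: subspace_add[OF subspace_chi_span] cscale_chi_span)
qed

text \<open>Truncations of \<open>f\<close> to finitely many windows are dominated by
  \<open>f\<close> itself and converge pointwise.\<close>

lemma chi_span_UNIV: "chi_span = UNIV"
proof -
  have "abs_l2 f \<in> chi_span" if f: "f \<in> L2" for f
  proof -
    define F where "F N t = (\<Sum>n\<in>{- int N..int N}. window n f t)" for N t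
    have F: "F N t = (if \<lfloor>t\<rfloor> \<in> {- int N..int N} then f t else 0)" for N t
      by (simp add: F_def window_def)
    have "abs_l2 (F N) \<in> chi_span" for N
      unfolding F_def[abs_def] using f
      by (simp add: abs_l2_sum L2_window window_L2_chi_span subspace_sum[OF subspace_chi_span])
    then show ?thesis
    proof (rule closed_sequentially[OF closed_chi_span])
      show "(\<lambda>N. abs_l2 (F N)) \<longlonglongrightarrow> abs_l2 f"
      proof (rule abs_l2_tendsto_dominated(2))
        show "F N \<in> borel_measurable borel" "f \<in> borel_measurable borel" for N
          using f unfolding F_def[abs_def] by (auto intro!: borel_measurable_sum measurable_window L2_measurable)
        show "integrable lborel (\<lambda>t. (cmod (f t))\<^sup>2)" using f by (simp add: L2_iff)
        show "AE t in lborel. cmod (F N t) \<le> cmod (f t)" for N by (simp add: F)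
        have "(\<lambda>N. F N t) \<longlonglongrightarrow> f t" for t
        proof (rule tendsto_eventually)
          have "F N t = f t" if "N \<ge> nat \<bar>\<lfloor>t\<rfloor>\<bar>" for N
            using that by (auto simp: F)
          then show "eventually (\<lambda>N. F N t = f t) sequentially"
            by (auto simp: eventually_sequentially)
        qed
        then show "AE t in lborel. (\<lambda>N. F N t) \<longlonglongrightarrow> f t" by simp
      qed
    qed
  qed
  then have "x \<in> chi_span" for x by (cases x) simp
  then show ?thesis by blast
qed

section \<open>Continuity of the time-frequency shifts\<close>

lemma chi_tendsto:
  assumes "x \<longlonglongrightarrow> a" "a \<noteq> 0" "a \<noteq> 1"
  shows "(\<lambda>m. chi (x m)) \<longlonglongrightarrow> chi a"
proof (rule tendsto_eventually)
  have chi: "chi t = (if 0 \<le> t \<and> t < 1 then 1 else 0)" for t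
    by (simp add: chi_def floor_eq_iff)
  consider "a < 0" | "0 < a" "a < 1" | "1 < a" using assms(2,3) by linarith
  then show "eventually (\<lambda>m. chi (x m) = chi a) sequentially"
  proof cases
    case 1
    from order_tendstoD(2)[OF assms(1) this] show ?thesis
      by eventually_elim (use 1 in \<open>simp add: chi\<close>)
  next
    case 2
    from order_tendstoD(1)[OF assms(1) 2(1)] order_tendstoD(2)[OF assms(1) 2(2)] show ?thesis
      by eventually_elim (use 2 in \<open>simp add: chi\<close>)
  next
    case 3
    from order_tendstoD(1)[OF assms(1) this] show ?thesis
      by eventually_elim (use 3 in \<open>simp add: chi\<close>)
  qed
qed

text \<open>Along a convergent sequence of shifts the supports stay in one bounded interval, and the
  functions converge except possibly at the two jumps of the limit.\<close>

lemma continuous_chi_sys: "continuous_on UNIV chi_sys"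
  unfolding continuous_on_sequentially comp_def
proof (intro allI ballI impI)
  fix x :: "nat \<Rightarrow> real \<times> real" and z
  assume "(\<forall>n. x n \<in> UNIV) \<and> x \<longlonglongrightarrow> z"
  then have lim: "x \<longlonglongrightarrow> z" by simp
  then have lim1: "(\<lambda>m. fst (x m)) \<longlonglongrightarrow> fst z" and lim2: "(\<lambda>m. snd (x m)) \<longlonglongrightarrow> snd z"
    by (auto intro: tendsto_fst tendsto_snd)
  obtain K where K: "\<And>m. \<bar>fst (x m)\<bar> \<le> K"
    using convergent_imp_Bseq[OF convergentI[OF lim1]] by (auto simp: Bseq_def)
  have "(\<lambda>m. abs_l2 (tf_shift chi (x m))) \<longlonglongrightarrow> abs_l2 (tf_shift chi z)"
  proof (rule abs_l2_tendsto_dominated(2))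
    show "tf_shift chi (x m) \<in> borel_measurable borel" "tf_shift chi z \<in> borel_measurable borel" for m
      by (auto intro: L2_measurable L2_tf_shift L2_chi)
    have "(\<lambda>t. (indicator {- K..K + 1} t :: real)\<^sup>2) = indicator {- K..K + 1}"
      by (auto simp: indicator_def fun_eq_iff)
    moreover have "integrable lborel (indicator {- K..K + 1} :: real \<Rightarrow> real)"
      by (rule integrable_real_indicator) (auto simp: emeasure_lborel_Icc_eq)
    ultimately show "integrable lborel (\<lambda>t. (indicator {- K..K + 1} t :: real)\<^sup>2)"
      by (simp only:)
    show "AE t in lborel. cmod (tf_shift chi (x m) t) \<le> indicator {- K..K + 1} t" for m
    proof (rule AE_I2)
      fix t
      show "cmod (tf_shift chi (x m) t) \<le> indicator {- K..K + 1} t"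
        using K[of m] by (auto simp: tf_shift_def chi_def norm_mult indicator_def floor_eq_iff abs_le_iff)
    qed
    have "AE t in lborel. t \<noteq> fst z \<and> t \<noteq> fst z + 1"
      using AE_lborel_singleton[of "fst z"] AE_lborel_singleton[of "fst z + 1"] by eventually_elim simp
    then show "AE t in lborel. (\<lambda>m. tf_shift chi (x m) t) \<longlonglongrightarrow> tf_shift chi z t"
    proof eventually_elim
      case (elim t)
      have "(\<lambda>m. chi (t - fst (x m))) \<longlonglongrightarrow> chi (t - fst z)"
        using elim by (intro chi_tendsto tendsto_intros lim1) auto
      moreover have "(\<lambda>m. cis (2 * pi * snd (x m) * t)) \<longlonglongrightarrow> cis (2 * pi * snd z * t)"
        by (intro tendsto_intros lim2)
      ultimately show ?case
        unfolding tf_shift_def by (rule tendsto_mult[rotated])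
    qed
  qed
  then show "(\<lambda>n. chi_sys (x n)) \<longlonglongrightarrow> chi_sys z"
    by (simp add: tfs_abs_l2 L2_chi)
qed

lemma continuous_on_cscale:
  assumes "continuous_on S c" "continuous_on S f"
  shows "continuous_on S (\<lambda>z. cscale (c z) (f z))"
proof -
  have "bounded_bilinear cscale"
  proof
    show "\<exists>K. \<forall>a b. norm (cscale a b) \<le> norm a * norm b * K"
      by (intro exI[of _ 1]) (simp add: norm_cscale)
  qed (auto simp: cscale_add_left cscale_add_right cscale_cscale simp flip: cscale_of_real, auto simp: scaleR_conv_of_real mult.commute)
  then show ?thesis using assms by (rule bounded_bilinear.continuous_on)
qed

text \<open>The vectors with continuous orbit form a closed subspace: shifts are isometries, so
  convergence of vectors makes their orbits converge uniformly in \<open>z\<close>. This subspace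
  contains the reference system and its complex multiples, whose span is dense.\<close>

lemma continuous_tfs: "continuous_on UNIV (\<lambda>z. tfs z u)"
proof -
  define A where "A = {u. continuous_on UNIV (\<lambda>z. tfs z u)}"
  have "subspace A"
    by (auto simp: A_def subspace_def linear_0[OF linear_tfs] linear_add[OF linear_tfs]
        linear_scale[OF linear_tfs] intro!: continuous_intros)
  moreover have "cscale c (chi_sys z') \<in> A" for c z'
  proof -
    have "continuous_on UNIV (\<lambda>z. chi_sys (z + z'))"
      by (rule continuous_on_compose2[OF continuous_chi_sys]) (auto intro!: continuous_intros)
    then have "continuous_on UNIV (\<lambda>z. cscale c (cscale (cis (- 2 * pi * snd z' * fst z)) (chi_sys (z + z'))))"
      by (intro continuous_on_cscale continuous_intros)
    then show ?thesis
      by (simp add: A_def tfs_cscale tfs_tfs)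
  qed
  ultimately have span: "cspan_l2 (chi_sys ` lattice (1, 0) (0, 1)) \<subseteq> A"
    unfolding cspan_l2_def by (intro span_minimal) auto
  have "closed A"
    unfolding closed_sequential_limits
  proof (intro allI impI, elim conjE)
    fix x u assume x: "\<forall>n. x n \<in> A" and lim: "x \<longlonglongrightarrow> u"
    have "continuous_on UNIV (\<lambda>z. tfs z u)"
    proof (rule uniform_limit_theorem)
      show "\<forall>\<^sub>F n in sequentially. continuous_on UNIV (\<lambda>z. tfs z (x n))"
        using x by (simp add: A_def)
      show "uniform_limit UNIV (\<lambda>n z. tfs z (x n)) (\<lambda>z. tfs z u) sequentially"
      proof (rule uniform_limitI)
        fix e :: real assume "e > 0"
        with lim have "\<forall>\<^sub>F n in sequentially. dist (x n) u < e" by (rule tendstoD)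
        then show "\<forall>\<^sub>F n in sequentially. \<forall>z\<in>UNIV. dist (tfs z (x n)) (tfs z u) < e"
          by eventually_elim (simp add: dist_norm norm_tfs flip: linear_diff[OF linear_tfs])
      qed
    qed simp
    then show "u \<in> A" by (simp add: A_def)
  qed
  then have "chi_span \<subseteq> A"
    unfolding chi_span_def using span by (rule closure_minimal[rotated])
  then show ?thesis
    using chi_span_UNIV by (auto simp: A_def)
qed

text \<open>The factor \<open>c\<close> is there because \<open>inner\<close> is only a real part:
  vanishing for all \<open>c\<close> amounts to complex orthogonality. Different windows have
  disjoint supports; on a common window a nonconstant exponential is integrated over full
  periods.\<close>

lemma inner_chi_sys_eq_0:
  assumes "(n, k) \<noteq> (n', k')"
  shows "inner (chi_sys (of_int n, of_int k)) (cscale c (chi_sys (of_int n', of_int k'))) = 0"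
proof -
  have L2: "window n (\<lambda>t. cis (2 * pi * of_int k * t)) \<in> L2" for n k
    by (rule L2_window_bounded[where B = 1]) measurable
  have inner: "inner (chi_sys (of_int n, of_int k)) (cscale c (chi_sys (of_int n', of_int k'))) =
      (LINT t|lborel. Re (window n (\<lambda>t. cis (2 * pi * of_int k * t)) t * cnj (c * window n' (\<lambda>t. cis (2 * pi * of_int k' * t)) t)))"
    by (simp add: chi_sys_int cscale_abs_l2 inner_abs_l2 L2 L2_cmult del: times_complex.sel complex_cnj_mult)
  show ?thesis
  proof (cases "n = n'")
    case False
    then have "window n (\<lambda>t. cis (2 * pi * of_int k * t)) t *
        cnj (c * window n' (\<lambda>t. cis (2 * pi * of_int k' * t)) t) = 0" for t
      by (auto simp: window_def)
    then show ?thesis unfolding inner by (simp only:) simp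
  next
    case True
    define m where "m = k - k'"
    have m: "m \<noteq> 0" using True assms by (simp add: m_def)
    define f where "f t = Re (cnj c * cis (2 * pi * of_int m * t))" for t
    \<comment> \<open>An antiderivative of \<open>f\<close> of period 1, so its increment over the
      window vanishes.\<close>
    define F where "F t = Im (cnj c * cis (2 * pi * of_int m * t)) / (2 * pi * of_int m)" for t
    have deriv: "(F has_real_derivative f t) (at t)" for t
      unfolding F_def f_def using m
      by (auto intro!: derivative_eq_intros simp: field_simps)
    have "has_bochner_integral lborel (\<lambda>t. f t * indicator {real_of_int n..of_int n + 1} t) (F (of_int n + 1) - F (of_int n))"
    proof (rule has_bochner_integral_FTC_Icc_real)
      have "continuous_on UNIV f" unfolding f_def by (intro continuous_intros)
      then show "isCont f t" for t by (simp add: continuous_on_eq_continuous_at)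
    qed (use deriv in auto)
    moreover have "F (of_int n + 1) = F (of_int n)"
    proof -
      have "cis (2 * pi * of_int m * (of_int n + 1)) = cis (2 * pi * of_int m * of_int n) * cis (2 * pi * of_int m)"
        by (simp add: cis_mult algebra_simps)
      then show ?thesis by (simp add: F_def)
    qed
    ultimately have "(LINT t|lborel. f t * indicator {real_of_int n..of_int n + 1} t) = 0"
      by (simp add: has_bochner_integral_iff)
    moreover have "(LINT t|lborel. Re (window n (\<lambda>t. cis (2 * pi * of_int k * t)) t * cnj (c * window n' (\<lambda>t. cis (2 * pi * of_int k' * t)) t)))
        = (LINT t|lborel. f t * indicator {real_of_int n..of_int n + 1} t)"
    proof (rule integral_cong_AE)
      \<comment> \<open>The window is half-open and the interval of the fundamental theorem is
        closed; they differ in the point \<open>n + 1\<close>.\<close>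
      show "AE t in lborel. Re (window n (\<lambda>t. cis (2 * pi * of_int k * t)) t * cnj (c * window n' (\<lambda>t. cis (2 * pi * of_int k' * t)) t))
          = f t * indicator {real_of_int n..of_int n + 1} t"
        using AE_lborel_singleton[of "of_int n + 1"]
      proof eventually_elim
        case (elim t)
        have "cis (2 * pi * of_int k * t) * cnj (c * cis (2 * pi * of_int k' * t)) = cnj c * cis (2 * pi * of_int m * t)"
          by (simp add: cis_cnj m_def cis_mult algebra_simps)
        moreover have "\<lfloor>t\<rfloor> = n \<longleftrightarrow> t \<in> {real_of_int n..of_int n + 1}"
          using elim by (auto simp: floor_eq_iff)
        ultimately show ?case
          using True unfolding window_def f_def indicator_def by (simp del: times_complex.sel complex_cnj_mult)
      qed
      show "(\<lambda>t. Re (window n (\<lambda>t. cis (2 * pi * of_int k * t)) t * cnj (c * window n' (\<lambda>t. cis (2 * pi * of_int k' * t)) t))) \<in> borel_measurable lborel"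
        by measurable
      show "(\<lambda>t. f t * indicator {real_of_int n..of_int n + 1} t) \<in> borel_measurable lborel"
        unfolding f_def by measurable
    qed
    ultimately show ?thesis unfolding inner by simp
  qed
qed

lemma norm_chi: "norm (abs_l2 chi) = 1"
proof -
  have "(\<lambda>t. (cmod (chi t))\<^sup>2) = indicator {0..<1}"
    by (auto simp: chi_def fun_eq_iff indicator_def floor_eq_iff)
  then show ?thesis by (simp add: norm_abs_l2 L2_chi l2norm_def)
qed

text \<open>By orthogonality the distance is at least the norm of \<open>chi_sys p\<close>, so the
  separation constant of the reference system is 1.\<close>

lemma chi_sys_separated:
  assumes p: "p \<in> lattice (1, 0) (0, 1)" and y: "y \<in> cspan_l2 (chi_sys ` (lattice (1, 0) (0, 1) - {p}))"
  shows "1 \<le> norm (chi_sys p - y)"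
proof -
  have "inner (chi_sys p) y = 0"
    using y unfolding cspan_l2_def
  proof (induction rule: span_induct)
    case base
    show ?case by (auto simp: subspace_def inner_add_right)
  next
    case (step x)
    then obtain c q where q: "x = cscale c (chi_sys q)" "q \<in> lattice (1, 0) (0, 1)" "q \<noteq> p" by blast
    obtain n k n' k' where nk: "p = (of_int n, of_int k)" "q = (of_int n', of_int k')"
      using p q(2) unfolding mem_int_lattice by blast
    then have "(n, k) \<noteq> (n', k')" using q(3) by auto
    then show ?case unfolding q(1) nk by (rule inner_chi_sys_eq_0)
  qed
  then have "(norm (chi_sys p - y))\<^sup>2 = (norm (chi_sys p))\<^sup>2 + (norm y)\<^sup>2"
    by (simp add: power2_norm_eq_inner inner_diff_left inner_diff_right inner_commute)
  then have "1\<^sup>2 \<le> (norm (chi_sys p - y))\<^sup>2"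
    by (simp add: norm_tfs norm_chi)
  then show ?thesis by (rule power2_le_imp_le) simp
qed

section \<open>Lattice Gabor systems\<close>

lemma abs_l2_tf_shift_image:
  assumes "g \<in> L2"
  shows "abs_l2 ` tf_shift g ` I = (\<lambda>z. tfs z (abs_l2 g)) ` I"
  using assms by (simp add: image_image tfs_abs_l2)

lemma norm_abs_l2_diff:
  "f \<in> L2 \<Longrightarrow> h \<in> L2 \<Longrightarrow> l2norm (\<lambda>t. f t - h t) = norm (abs_l2 f - abs_l2 h)"
  by (simp add: L2_diff norm_abs_l2 flip: abs_l2_diff)

lemma in_closed_span_iff:
  assumes f: "f \<in> L2" and S: "S \<subseteq> L2"
  shows "in_closed_span f S \<longleftrightarrow> abs_l2 f \<in> closure (cspan_l2 (abs_l2 ` S))"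
proof -
  have "h \<in> L2" if "h \<in> cspan S" for h
    using L2_cspan[OF S] that by blast
  then have "l2norm (\<lambda>t. f t - h t) = dist (abs_l2 h) (abs_l2 f)" if "h \<in> cspan S" for h
    using that f by (simp add: norm_abs_l2_diff dist_norm norm_minus_commute)
  then show ?thesis
    by (auto simp: in_closed_span_def closure_approachable abs_l2_cspan[OF S, symmetric])
qed

lemma zero_in_cspan: "(\<lambda>t. 0) \<in> cspan S"
  unfolding cspan_def by (intro CollectI exI[of _ "{}"]) auto

lemma le_l2dist_span:
  assumes "f \<in> L2" "S \<subseteq> L2"
    and sep: "\<And>y. y \<in> cspan_l2 (abs_l2 ` S) \<Longrightarrow> \<delta> \<le> norm (abs_l2 f - y)"
  shows "\<delta> \<le> l2dist_span f S"
  unfolding l2dist_span_def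
proof (rule cINF_greatest)
  show "cspan S \<noteq> {}" using zero_in_cspan by blast
  fix h assume h: "h \<in> cspan S"
  then have "abs_l2 h \<in> cspan_l2 (abs_l2 ` S)"
    using abs_l2_cspan[OF assms(2)] by blast
  then show "\<delta> \<le> l2norm (\<lambda>t. f t - h t)"
    using sep h L2_cspan[OF assms(2)] assms(1) by (simp add: norm_abs_l2_diff subset_iff)
qed

lemma lattice_diff:
  assumes "p \<in> lattice v w" "q \<in> lattice v w"
  shows "q - p \<in> lattice v w"
proof -
  obtain n k n' k' where "p = of_int n *\<^sub>R v + of_int k *\<^sub>R w" "q = of_int n' *\<^sub>R v + of_int k' *\<^sub>R w"
    using assms unfolding lattice_def by blast
  then have "q - p = of_int (n' - n) *\<^sub>R v + of_int (k' - k) *\<^sub>R w"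
    by (simp add: algebra_simps)
  then show ?thesis unfolding lattice_def by blast
qed

lemma zero_in_lattice: "0 \<in> lattice v w"
  unfolding lattice_def by (intro CollectI exI[of _ 0]) simp

text \<open>The time-frequency shift by \<open>-p\<close> is, up to phases, a unitary symmetry of the system, so a
  lower bound for the distance at the point 0 is valid at every point.\<close>

lemma minimal_sys_separated:
  assumes g: "g \<in> L2" and minimal: "minimal_sys (lattice v w) (tf_shift g)"
  obtains \<delta> where "\<delta> > 0" "\<And>p y. p \<in> lattice v w \<Longrightarrow>
    y \<in> cspan_l2 ((\<lambda>z. tfs z (abs_l2 g)) ` (lattice v w - {p})) \<Longrightarrow> \<delta> \<le> norm (tfs p (abs_l2 g) - y)"
proof -
  let ?e = "\<lambda>z. tfs z (abs_l2 g)"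
  have "\<not> in_closed_span (tf_shift g 0) (tf_shift g ` (lattice v w - {0}))"
    using minimal zero_in_lattice by (auto simp: minimal_sys_def)
  then have "?e 0 \<notin> closure (cspan_l2 (?e ` (lattice v w - {0})))"
    using g by (subst (asm) in_closed_span_iff) (auto simp: L2_tf_shift tfs_abs_l2 abs_l2_tf_shift_image)
  then obtain \<delta> where \<delta>: "\<delta> > 0" "\<And>y. y \<in> cspan_l2 (?e ` (lattice v w - {0})) \<Longrightarrow> \<delta> \<le> norm (?e 0 - y)"
    unfolding closure_approachable by (auto simp: dist_norm norm_minus_commute not_less)
  have "\<delta> \<le> norm (?e p - y)" if p: "p \<in> lattice v w" and y: "y \<in> cspan_l2 (?e ` (lattice v w - {p}))" for p y
  proof -
    have "tfs (- p) y \<in> cspan_l2 (?e ` ((+) (- p) ` (lattice v w - {p})))"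
      using y by (rule tfs_cspan_l2)
    moreover have "(+) (- p) ` (lattice v w - {p}) \<subseteq> lattice v w - {0}"
    proof
      fix z assume "z \<in> (+) (- p) ` (lattice v w - {p})"
      then obtain q where "z = q - p" "q \<in> lattice v w" "q \<noteq> p" by force
      then show "z \<in> lattice v w - {0}" using lattice_diff[OF p] by simp
    qed
    ultimately have y': "tfs (- p) y \<in> cspan_l2 (?e ` (lattice v w - {0}))"
      by (metis subsetD[OF cspan_l2_mono[OF image_mono]])
    \<comment> \<open>Composing the shifts by \<open>-p\<close> and \<open>p\<close> gives the shift
      by 0 up to a factor of modulus 1.\<close>
    obtain c where c: "cmod c = 1" "tfs (- p) (?e p) = cscale c (?e 0)"
      by (metis tfs_tfs norm_cis left_minus)
    have "\<delta> \<le> norm (cscale c (?e 0) - tfs (- p) y)"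
      using \<delta> y' c(1) by (intro complex_separation[of "?e ` (lattice v w - {0})"]) auto
    also have "\<dots> = norm (?e p - y)"
      by (simp add: norm_tfs flip: c(2) linear_diff[OF linear_tfs])
    finally show ?thesis .
  qed
  then show ?thesis using that \<delta>(1) by blast
qed

lemma complete_sys_closure:
  assumes g: "g \<in> L2" and complete: "complete_sys I (tf_shift g)"
  shows "closure (cspan_l2 ((\<lambda>z. tfs z (abs_l2 g)) ` I)) = UNIV"
proof -
  have "abs_l2 f \<in> closure (cspan_l2 ((\<lambda>z. tfs z (abs_l2 g)) ` I))" if "f \<in> L2" for f
  proof -
    have "in_closed_span f (tf_shift g ` I)"
      using complete that by (simp add: complete_sys_def)
    then show ?thesis
      using g that by (subst (asm) in_closed_span_iff) (auto simp: L2_tf_shift abs_l2_tf_shift_image)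
  qed
  then have "x \<in> closure (cspan_l2 ((\<lambda>z. tfs z (abs_l2 g)) ` I))" for x by (cases x) simp
  then show ?thesis by blast
qed

text \<open>If the determinant vanishes, a nonzero coordinate of \<open>v\<close> exhibits
  \<open>w\<close> as a multiple of \<open>v\<close>. The assumption \<open>v \<noteq> w\<close>
  matters, because \<open>{v, v}\<close> is a singleton and can be independent.\<close>

lemma det2_nonzero:
  assumes "independent {v, w}" "v \<noteq> w"
  shows "det2 v w \<noteq> 0"
proof
  assume det: "det2 v w = 0"
  have v: "v \<noteq> 0" using assms(1) dependent_zero by auto
  have "fst v *\<^sub>R w = fst w *\<^sub>R v" "snd v *\<^sub>R w = snd w *\<^sub>R v"
    using det by (auto simp: det2_def prod_eq_iff algebra_simps)
  moreover have "fst v \<noteq> 0 \<or> snd v \<noteq> 0" using v by (auto simp: prod_eq_iff)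
  ultimately obtain a b where "a \<noteq> 0" "a *\<^sub>R w = b *\<^sub>R v" by metis
  then have "w = (b / a) *\<^sub>R v"
    by (metis divide_inverse_commute left_inverse scaleR_one scaleR_scaleR)
  then have "w \<in> span {v}" by (simp add: span_base span_scale)
  moreover have "w \<notin> span {v}"
    using assms by (auto simp: dependent_def insert_Diff_if)
  ultimately show False by blast
qed

lemma det2_unit: "det2 (1, 0) (0, 1) = 1"
  by (simp add: det2_def)

theorem theorem3:
  fixes v w :: "real \<times> real" and g :: "real \<Rightarrow> complex"
  assumes "independent {v, w}" and "v \<noteq> w"
    and "g \<in> L2"
  shows "(minimal_sys (lattice v w) (tf_shift g) \<longrightarrow>
            unif_minimal_sys (lattice v w) (tf_shift g) \<and> lattice_density v w \<le> 1)
       \<and> (complete_sys (lattice v w) (tf_shift g) \<longrightarrow> lattice_density v w \<ge> 1)"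
proof (intro conjI impI)
  have det: "det2 v w \<noteq> 0" using det2_nonzero assms by blast
  {
    assume "minimal_sys (lattice v w) (tf_shift g)"
    then obtain \<delta> where \<delta>: "\<delta> > 0" and sep: "\<And>p y. p \<in> lattice v w \<Longrightarrow>
        y \<in> cspan_l2 ((\<lambda>z. tfs z (abs_l2 g)) ` (lattice v w - {p})) \<Longrightarrow> \<delta> \<le> norm (tfs p (abs_l2 g) - y)"
      using minimal_sys_separated[OF \<open>g \<in> L2\<close>] by metis
    \<comment> \<open>Halving \<delta> gives the strict inequality that uniform minimality
      demands.\<close>
    have "\<delta> / 2 < l2dist_span (tf_shift g p) (tf_shift g ` (lattice v w - {p}))" if "p \<in> lattice v w" for p
    proof -
      have "\<delta> \<le> l2dist_span (tf_shift g p) (tf_shift g ` (lattice v w - {p}))"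
        using sep[OF that] assms(3)
        by (intro le_l2dist_span) (auto simp: L2_tf_shift abs_l2_tf_shift_image tfs_abs_l2)
      then show ?thesis using \<delta> by simp
    qed
    then show "unif_minimal_sys (lattice v w) (tf_shift g)"
      using \<delta> unfolding unif_minimal_sys_def by (intro exI[of _ "\<delta> / 2"]) auto
    \<comment> \<open>Here the reference system is the complete one and the given system the
      separated one.\<close>
    have "\<bar>det2 (1, 0) (0, 1)\<bar> \<le> \<bar>det2 v w\<bar>"
      using chi_span_UNIV unfolding chi_span_def
      by (intro density_comparison[OF _ det _ continuous_tfs \<delta> sep]) (simp_all add: det2_unit)
    then show "lattice_density v w \<le> 1"
      by (simp add: lattice_density_def det2_unit divide_le_eq)
  }
  assume "complete_sys (lattice v w) (tf_shift g)"
  \<comment> \<open>The roles are exchanged, with separation constant 1 for the reference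
    system.\<close>
  then have "\<bar>det2 v w\<bar> \<le> \<bar>det2 (1, 0) (0, 1)\<bar>"
    by (intro density_comparison[OF det _ complete_sys_closure[OF assms(3)] continuous_tfs zero_less_one chi_sys_separated])
      (simp_all add: det2_unit)
  then show "1 \<le> lattice_density v w"
    using det by (simp add: lattice_density_def det2_unit le_divide_eq)
qed

end
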